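(* Let $q$ be a complex number with $|q|<1$ (equivalently, regard all series as formal power series in $q$). For $n\ge 0$ define $$\omega_n(q)=\sum_{j=0}^{n}\sum_{k=0}^{j}{j \brack k}_q{n-k \brack j}_q\,q^{j(j+1)/2+k(k+1)/2},\qquad \Theta_n(q)=\sum_{j=0}^{n}\sum_{k=0}^{j}{j \brack k}_q{n-k \brack j}_q\,q^{j(j+1)/2+k(k-1)/2}.$$ Then $$\sum_{n\ge0}\left(\frac{(-q^2;q^2)_{\infty}}{(q;q^2)_{\infty}}-\omega_n(q)\right)=\frac{(-q^2;q^2)_{\infty}}{(q;q^2)_{\infty}}\left(-\frac{1}{2}+2\sum_{n\ge1}\frac{q^{2n-1}}{1-q^{2n-1}}\right)+\frac{1}{2}\sum_{n\ge0}\frac{(q;q)_n(-1)^nq^{n(n+1)/2}}{(-q;q)_{n}},$$ and $$\sum_{n\ge0}\left(\frac{(-q;q^2)_{\infty}}{(q;q^2)_{\infty}}-\Theta_n(q)\right)=2\frac{(-q;q^2)_{\infty}}{(q;q^2)_{\infty}}\sum_{n\ge1}\frac{q^{2n-1}}{1-q^{2n-1}}+\sum_{n\ge1}\frac{(q;q)_{n-1}(-1)^nq^{n(n+1)/2}}{(-q;q)_{n}}.$$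
   Context: For a complex number $V$ and integer $n\ge0$, $(V;q)_n=(1-V)(1-Vq)\cdots(1-Vq^{n-1})$ (with $(V;q)_0=1$), and $(V;q)_\infty=\prod_{i\ge0}(1-Vq^i)$. The Gaussian binomial coefficient is ${n \brack m}_q=\frac{(q;q)_n}{(q;q)_m(q;q)_{n-m}}$ for $0\le m\le n$. The sequences $\omega_n,\Theta_n$ are the "$q$-Pell sequences", with generating functions $\sum_{n\ge0}\omega_n(q)t^n=\sum_{n\ge0}\frac{(-tq;q)_nt^nq^{n(n+1)/2}}{(t;q)_{n+1}}$ and $\sum_{n\ge0}\Theta_n(q)t^n=\sum_{n\ge0}\frac{(-t;q)_nt^nq^{n(n+1)/2}}{(t;q)_{n+1}}$.
   Formalization: In the second identity the sign before the last sum over n≥1 is minus instead of the printed plus; with plus the identity fails already at first order in q (left side 3q+O(q²), printed right side q+O(q²)). *)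

theory Defs
  imports "HOL-Analysis.Analysis"
begin

definition qpoch :: "complex \<Rightarrow> complex \<Rightarrow> nat \<Rightarrow> complex" where
  "qpoch V q n = (\<Prod>i<n. 1 - V * q ^ i)"

definition qpoch_inf :: "complex \<Rightarrow> complex \<Rightarrow> complex" where
  "qpoch_inf V q = (\<Prod>i. 1 - V * q ^ i)"

text \<open>The value is 0 outside the range \<open>m \<le> n\<close>; this case occurs in the double sums below,
  where the upper entry \<open>n - k\<close> may be smaller than \<open>j\<close>.\<close>

definition qbinomial :: "complex \<Rightarrow> nat \<Rightarrow> nat \<Rightarrow> complex" where
  "qbinomial q n m =
     (if m \<le> n then qpoch q q n / (qpoch q q m * qpoch q q (n - m)) else 0)"

definition qpell_omega :: "nat \<Rightarrow> complex \<Rightarrow> complex" where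
  "qpell_omega n q =
     (\<Sum>j=0..n. \<Sum>k=0..j. qbinomial q j k * qbinomial q (n - k) j *
        q ^ (j * (j + 1) div 2 + k * (k + 1) div 2))"

definition qpell_Theta :: "nat \<Rightarrow> complex \<Rightarrow> complex" where
  "qpell_Theta n q =
     (\<Sum>j=0..n. \<Sum>k=0..j. qbinomial q j k * qbinomial q (n - k) j *
        q ^ (j * (j + 1) div 2 + k * (k - 1) div 2))"

end

theory Submission
  imports Defs "HOL-Complex_Analysis.Complex_Analysis"
begin

text \<open>
  Put \<open>w = q\<close>, \<open>e = 0\<close> for \<open>\<omega>\<close> and \<open>w = 1\<close>, \<open>e = 1\<close> for \<open>\<Theta>\<close>. The generating function of either sequence is
  \<open>G(t) / (1 - t)\<close> with \<open>G(t) = \<Sum>\<^sub>n (-tw;q)\<^sub>n t\<^sup>n q\<^bsup>n(n+1)/2\<^esup> / (tq;q)\<^sub>n\<close>, which is holomorphic in \<open>|t| < 1/|q|\<close>.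
  Hence the sum of the defects \<open>G(1) - a\<^sub>n\<close> is \<open>G'(1)\<close>, while \<open>G(1)\<close> is given by Lebesgue's identity.

  To find \<open>G'(1)\<close>, continue the series defining \<open>G\<close> to all integers \<open>n\<close>. The terms with \<open>n < 0\<close> sum to
  \<open>(1 - 1/t) K(t)\<close>, and \<open>K(1)\<close> is, up to a constant factor, the last sum in the theorem. Multiplied by
  \<open>t\<^bsup>1-e\<^esup> (tq;q)\<^sub>\<infinity> (-q\<^sup>e/t;q)\<^sub>\<infinity>\<close>, the bilateral series becomes a triple sum, in which (by Euler's expansion of
  the infinite products) the terms belonging to fixed Euler indices \<open>a\<close>, \<open>b\<close> form a theta series in
  \<open>t\<^bsup>2n+c\<^esup> q\<^bsup>n(n+c)\<^esup>\<close> with \<open>c = a - b + 1 - e\<close>. The substitution \<open>n \<mapsto> -n-c\<close> shows that this is invariant under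
  \<open>t \<mapsto> 1/t\<close>, so its derivative at \<open>t = 1\<close> vanishes. This is a linear equation for \<open>G'(1)\<close>, in which the
  logarithmic derivatives of the products give the Lambert series.
\<close>

section \<open>Series with superexponentially decaying terms\<close>

lemma summable_prod_geometric:
  fixes C r :: real
  assumes "0 \<le> r" "r < 1" "0 \<le> C"
  shows "summable (\<lambda>n. \<Prod>i<n. C * r ^ i)"
proof -
  have "(\<lambda>n. C * r ^ n) \<longlonglongrightarrow> C * 0"
    using assms by (intro tendsto_intros LIMSEQ_power_zero) auto
  then have "eventually (\<lambda>n. C * r ^ n < 1/2) sequentially"
    by (intro order_tendstoD) auto
  then obtain N where N: "\<And>n. n \<ge> N \<Longrightarrow> C * r ^ n < 1/2"
    by (auto simp: eventually_sequentially)
  show ?thesis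
  proof (rule summable_ratio_test[of "1/2" N])
    fix n assume "n \<ge> N"
    have "0 \<le> (\<Prod>i<n. C * r ^ i)"
      using assms by (intro prod_nonneg) auto
    then show "norm (\<Prod>i<Suc n. C * r ^ i) \<le> 1/2 * norm (\<Prod>i<n. C * r ^ i)"
      using mult_right_mono[OF less_imp_le[OF N[OF \<open>n \<ge> N\<close>]], of "\<Prod>i<n. C * r ^ i"] assms
      by (simp add: abs_mult mult_ac)
  qed simp
qed

lemma norm_le_prod_geometric:
  fixes f :: "nat \<Rightarrow> 'a :: real_normed_vector"
  assumes "\<And>n. norm (f (Suc n)) \<le> C * r ^ n * norm (f n)" "0 \<le> r" "0 \<le> C"
  shows "norm (f n) \<le> norm (f 0) * (\<Prod>i<n. C * r ^ i)"
proof (induction n)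
  case (Suc n)
  have "norm (f (Suc n)) \<le> C * r ^ n * norm (f n)" by (rule assms)
  also have "\<dots> \<le> C * r ^ n * (norm (f 0) * (\<Prod>i<n. C * r ^ i))"
    using Suc assms by (intro mult_left_mono) auto
  finally show ?case by (simp add: mult_ac)
qed auto

text \<open>The ratio test in the form that suits \<open>q\<close>-series: a quadratic exponent of
  \<open>q\<close> makes the ratio of consecutive terms \<open>O(r ^ n)\<close>. The majorant
  depends on \<open>C\<close>, \<open>r\<close> and the first term only, so uniform bounds on these
  also give uniform convergence in a parameter.\<close>

lemma summable_norm_superexponential:
  fixes f :: "nat \<Rightarrow> 'a :: real_normed_vector"
  assumes "\<And>n. norm (f (Suc n)) \<le> C * r ^ n * norm (f n)" "0 \<le> r" "r < 1" "0 \<le> C"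
  shows "summable (\<lambda>n. norm (f n))"
proof (rule summable_comparison_test')
  show "summable (\<lambda>n. norm (f 0) * (\<Prod>i<n. C * r ^ i))"
    by (intro summable_mult summable_prod_geometric assms)
  show "norm (norm (f n)) \<le> norm (f 0) * (\<Prod>i<n. C * r ^ i)" for n
    using norm_le_prod_geometric[of f C r n] assms by simp
qed

lemma holomorphic_on_suminf_superexponential:
  fixes f :: "nat \<Rightarrow> complex \<Rightarrow> complex"
  assumes "open S" "\<And>n. f n holomorphic_on S"
    and "\<And>z. z \<in> S \<Longrightarrow> norm (f 0 z) \<le> B"
    and "\<And>n z. z \<in> S \<Longrightarrow> norm (f (Suc n) z) \<le> C * r ^ n * norm (f n z)"
    and "0 \<le> r" "r < 1" "0 \<le> C"
  shows "(\<lambda>z. \<Sum>n. f n z) holomorphic_on S"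
proof (rule holomorphic_uniform_sequence[OF \<open>open S\<close>])
  show "(\<lambda>z. \<Sum>i<n. f i z) holomorphic_on S" for n
    by (intro holomorphic_intros assms)
  have "uniform_limit S (\<lambda>n z. \<Sum>i<n. f i z) (\<lambda>z. \<Sum>n. f n z) sequentially"
  proof (rule Weierstrass_m_test)
    show "summable (\<lambda>n. B * (\<Prod>i<n. C * r ^ i))"
      by (intro summable_mult summable_prod_geometric assms)
    show "norm (f n z) \<le> B * (\<Prod>i<n. C * r ^ i)" if "z \<in> S" for n z
    proof -
      have "norm (f n z) \<le> norm (f 0 z) * (\<Prod>i<n. C * r ^ i)"
        by (rule norm_le_prod_geometric) (use assms that in auto)
      also have "\<dots> \<le> B * (\<Prod>i<n. C * r ^ i)"
        using assms that by (intro mult_right_mono prod_nonneg) auto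
      finally show ?thesis .
    qed
  qed
  then show "\<exists>d>0. cball x d \<subseteq> S \<and>
      uniform_limit (cball x d) (\<lambda>n z. \<Sum>i<n. f i z) (\<lambda>z. \<Sum>n. f n z) sequentially"
    if "x \<in> S" for x
    using that \<open>open S\<close> by (meson open_contains_cball uniform_limit_on_subset)
qed

lemma sums_Suc_zero:
  fixes f :: "nat \<Rightarrow> 'a :: real_normed_vector"
  assumes "f sums s" "f 0 = 0"
  shows "(\<lambda>n. f (Suc n)) sums s"
  using assms by (simp add: sums_Suc_iff)

section \<open>Finite and infinite q-Pochhammer symbols\<close>

lemma qpoch_0 [simp]: "qpoch V q 0 = 1"
  by (simp add: qpoch_def)

lemma qpoch_Suc: "qpoch V q (Suc n) = qpoch V q n * (1 - V * q ^ n)"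
  by (simp add: qpoch_def)

lemma qpoch_Suc_shift: "qpoch V q (Suc n) = (1 - V) * qpoch (V * q) q n"
  unfolding qpoch_def by (subst prod.lessThan_Suc_shift) (simp add: mult_ac)

lemma qpoch_nonzero:
  assumes "norm q < 1" "norm V < 1"
  shows "qpoch V q n \<noteq> 0"
proof -
  have "1 - V * q ^ i \<noteq> 0" for i
  proof
    assume "1 - V * q ^ i = 0"
    then have "norm V * norm q ^ i = 1"
      by (metis eq_iff_diff_eq_0 norm_mult norm_one norm_power)
    moreover have "norm V * norm q ^ i \<le> norm V * 1"
      using assms by (intro mult_left_mono power_le_one) auto
    ultimately show False using assms by simp
  qed
  then show ?thesis by (simp add: qpoch_def)
qed

lemma convergent_prod_qpoch:
  fixes q V :: complex
  assumes "norm q < 1"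
  shows "convergent_prod (\<lambda>i. 1 - V * q ^ i)"
proof -
  have "summable (\<lambda>i. norm (- V * q ^ i))"
    using assms by (auto simp: norm_mult norm_power intro!: summable_mult summable_geometric)
  then have "abs_convergent_prod (\<lambda>i. 1 - V * q ^ i)"
    by (simp add: abs_convergent_prod_conv_summable)
  then show ?thesis by (rule abs_convergent_prod_imp_convergent_prod)
qed

lemma qpoch_tendsto:
  assumes "norm q < 1"
  shows "qpoch V q \<longlonglongrightarrow> qpoch_inf V q"
proof -
  have "(\<lambda>n. \<Prod>i\<le>n. 1 - V * q ^ i) \<longlonglongrightarrow> qpoch_inf V q"
    unfolding qpoch_inf_def by (rule convergent_prod_LIMSEQ[OF convergent_prod_qpoch[OF assms]])
  then have "(\<lambda>n. qpoch V q (Suc n)) \<longlonglongrightarrow> qpoch_inf V q"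
    by (simp add: qpoch_def lessThan_Suc_atMost)
  then show ?thesis by (rule LIMSEQ_imp_Suc)
qed

lemma qpoch_inf_rec:
  assumes "norm q < 1"
  shows "qpoch_inf V q = (1 - V) * qpoch_inf (V * q) q"
proof (rule LIMSEQ_unique)
  show "(\<lambda>n. qpoch V q (Suc n)) \<longlonglongrightarrow> qpoch_inf V q"
    by (intro LIMSEQ_Suc qpoch_tendsto assms)
  show "(\<lambda>n. qpoch V q (Suc n)) \<longlonglongrightarrow> (1 - V) * qpoch_inf (V * q) q"
    unfolding qpoch_Suc_shift by (intro tendsto_intros qpoch_tendsto assms)
qed

lemma qpoch_inf_nonzero:
  assumes "norm q < 1" "norm V < 1"
  shows "qpoch_inf V q \<noteq> 0"
  unfolding qpoch_inf_def
proof (rule prodinf_nonzero[OF convergent_prod_qpoch[OF assms(1)]])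
  show "1 - V * q ^ i \<noteq> 0" for i
    using qpoch_nonzero[OF assms, of "Suc i"] by (simp add: qpoch_Suc)
qed

lemma qpoch_bounded:
  assumes "norm q < 1"
  obtains K where "K > 0" "\<And>n. norm (qpoch V q n) \<le> K"
  using convergent_imp_Bseq[OF convergentI[OF qpoch_tendsto[OF assms, of V]]] that
  by (auto elim!: BseqE)

lemma qpoch_inverse_bounded:
  assumes "norm q < 1" "norm V < 1"
  obtains K where "K > 0" "\<And>n. norm (1 / qpoch V q n) \<le> K"
proof -
  have lim: "(\<lambda>n. 1 / qpoch V q n) \<longlonglongrightarrow> 1 / qpoch_inf V q"
    by (intro tendsto_intros qpoch_tendsto qpoch_inf_nonzero assms)
  show ?thesis
    using convergent_imp_Bseq[OF convergentI[OF lim]] that by (auto elim!: BseqE)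
qed

lemma qpoch_inf_times_minus:
  assumes "norm q < 1"
  shows "qpoch_inf x q * qpoch_inf (- x) q = qpoch_inf (x ^ 2) (q ^ 2)"
proof (rule LIMSEQ_unique)
  have "norm (q ^ 2) < 1" using assms by (simp add: norm_power power_less_one_iff)
  then show "(\<lambda>n. qpoch (x ^ 2) (q ^ 2) n) \<longlonglongrightarrow> qpoch_inf (x ^ 2) (q ^ 2)"
    by (rule qpoch_tendsto)
  have "qpoch (x ^ 2) (q ^ 2) n = qpoch x q n * qpoch (- x) q n" for n
    unfolding qpoch_def prod.distrib[symmetric]
  proof (intro prod.cong refl)
    fix i
    have "(q ^ 2) ^ i = (q ^ i) ^ 2" by (metis mult.commute power_mult)
    then show "1 - x ^ 2 * (q ^ 2) ^ i = (1 - x * q ^ i) * (1 - (- x) * q ^ i)"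
      by (simp add: power2_eq_square algebra_simps)
  qed
  then show "(\<lambda>n. qpoch (x ^ 2) (q ^ 2) n) \<longlonglongrightarrow> qpoch_inf x q * qpoch_inf (- x) q"
    using assms by (auto intro!: tendsto_intros qpoch_tendsto)
qed

lemma qpoch_inf_even_odd:
  assumes "norm q < 1"
  shows "qpoch_inf x q = qpoch_inf x (q ^ 2) * qpoch_inf (x * q) (q ^ 2)"
proof (rule LIMSEQ_unique)
  have q2: "norm (q ^ 2) < 1" using assms by (simp add: norm_power power_less_one_iff)
  have "(\<lambda>n. qpoch x q (2 * n)) \<longlonglongrightarrow> qpoch_inf x q"
    using LIMSEQ_subseq_LIMSEQ[OF qpoch_tendsto[OF assms], of "\<lambda>n. 2 * n" x]
    by (simp add: o_def strict_mono_def)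
  also have "(\<lambda>n. qpoch x q (2 * n)) = (\<lambda>n. qpoch x (q ^ 2) n * qpoch (x * q) (q ^ 2) n)"
  proof
    show "qpoch x q (2 * n) = qpoch x (q ^ 2) n * qpoch (x * q) (q ^ 2) n" for n
    proof (induction n)
      case (Suc n)
      have "qpoch x q (2 * Suc n) = qpoch x q (2 * n) * (1 - x * q ^ (2 * n)) * (1 - x * q ^ (2 * n) * q)"
        by (simp add: qpoch_Suc mult_ac)
      then show ?case unfolding Suc qpoch_Suc power_mult by (simp add: mult_ac)
    qed simp
  qed
  finally show "(\<lambda>n. qpoch x (q ^ 2) n * qpoch (x * q) (q ^ 2) n) \<longlonglongrightarrow> qpoch_inf x q" .
  show "(\<lambda>n. qpoch x (q ^ 2) n * qpoch (x * q) (q ^ 2) n)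
          \<longlonglongrightarrow> qpoch_inf x (q ^ 2) * qpoch_inf (x * q) (q ^ 2)"
    by (intro tendsto_intros qpoch_tendsto q2)
qed

text \<open>Euler's identity between partitions into distinct parts and into odd parts: multiply by
  \<open>qpoch_inf q q\<close>, whose factors with even exponent cancel against
  \<open>qpoch_inf (q ^ 2) (q ^ 2)\<close>.\<close>

lemma qpoch_inf_minus_q:
  assumes "norm q < 1"
  shows "qpoch_inf (- q) q = 1 / qpoch_inf q (q ^ 2)"
proof -
  have q2: "norm (q ^ 2) < 1" using assms by (simp add: norm_power power_less_one_iff)
  have nz: "qpoch_inf (q ^ 2) (q ^ 2) \<noteq> 0" "qpoch_inf q (q ^ 2) \<noteq> 0"
    by (intro qpoch_inf_nonzero q2 assms)+
  have "qpoch_inf q (q ^ 2) * qpoch_inf (q ^ 2) (q ^ 2) * qpoch_inf (- q) q = qpoch_inf (q ^ 2) (q ^ 2)"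
    using qpoch_inf_times_minus[OF assms, of q] qpoch_inf_even_odd[OF assms, of q]
    by (simp add: power2_eq_square)
  with nz show ?thesis by (simp add: field_simps)
qed

section \<open>Euler's expansion of the infinite product\<close>

lemma choose_two_Suc: "Suc n * (Suc n - 1) div 2 = n * (n - 1) div 2 + n"
proof -
  have "Suc n * (Suc n - 1) = n * (n - 1) + n * 2" by (cases n) auto
  then show ?thesis by simp
qed

lemma triangular_Suc: "Suc n * (Suc n + 1) div 2 = n * (n + 1) div 2 + Suc n"
proof -
  have "Suc n * (Suc n + 1) = n * (n + 1) + Suc n * 2" by simp
  then show ?thesis by (simp only: div_mult_self1[OF zero_neq_numeral[symmetric]])
qed

text \<open>The coefficient of \<open>x ^ a\<close> in the expansion of
  \<open>qpoch_inf x q\<close>.\<close>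

definition euler_coeff :: "complex \<Rightarrow> nat \<Rightarrow> complex" where
  "euler_coeff q a = (- 1) ^ a * q ^ (a * (a - 1) div 2) / qpoch q q a"

lemma euler_coeff_Suc:
  assumes "norm q < 1"
  shows "euler_coeff q (Suc a) * (1 - q ^ Suc a) = - euler_coeff q a * q ^ a"
proof -
  have eq: "qpoch q q (Suc a) = qpoch q q a * (1 - q ^ Suc a)"
    by (simp add: qpoch_Suc)
  moreover have "qpoch q q (Suc a) \<noteq> 0" by (rule qpoch_nonzero) (use assms in auto)
  ultimately show ?thesis
    unfolding euler_coeff_def choose_two_Suc eq by (simp add: power_add)
qed

lemma norm_one_minus_power_ge:
  fixes q :: "'a :: real_normed_div_algebra"
  assumes "norm q < 1"
  shows "norm (1 - q ^ Suc a) \<ge> 1 - norm q"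
proof -
  have "norm q ^ Suc a \<le> norm q ^ 1"
    using assms by (intro power_decreasing) auto
  then have "norm (q ^ Suc a) \<le> norm q" by (metis norm_power power_one_right)
  then show ?thesis using norm_triangle_ineq2[of 1 "q ^ Suc a"] by simp
qed

lemma summable_euler:
  assumes "norm q < 1"
  shows "summable (\<lambda>a. norm (euler_coeff q a * x ^ a))"
proof (rule summable_norm_superexponential)
  fix a
  have "norm (euler_coeff q (Suc a)) * (1 - norm q)
          \<le> norm (euler_coeff q (Suc a)) * norm (1 - q ^ Suc a)"
    using norm_one_minus_power_ge[OF assms] by (intro mult_left_mono) auto
  also have "\<dots> = norm (euler_coeff q a) * norm q ^ a"
    using euler_coeff_Suc[OF assms, of a] by (metis norm_minus_cancel norm_mult norm_power)
  finally have "norm (euler_coeff q (Suc a)) \<le> norm (euler_coeff q a) * norm q ^ a / (1 - norm q)"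
    using assms by (simp add: field_simps)
  then have "norm (euler_coeff q (Suc a)) * norm x ^ Suc a
          \<le> norm (euler_coeff q a) * norm q ^ a / (1 - norm q) * norm x ^ Suc a"
    by (intro mult_right_mono) auto
  then show "norm (euler_coeff q (Suc a) * x ^ Suc a)
          \<le> norm x / (1 - norm q) * norm q ^ a * norm (euler_coeff q a * x ^ a)"
    by (simp add: norm_mult norm_power mult_ac)
qed (use assms in auto)

text \<open>Series and product obey the same equation \<open>E x = (1 - x) * E (x * q)\<close>. Its
  iteration drives the argument to 0, where continuity and \<open>E 0 = 1\<close> fix the
  value.\<close>

lemma euler_qpoch_inf:
  assumes q: "norm q < 1"
  shows "(\<lambda>a. euler_coeff q a * x ^ a) sums qpoch_inf x q"
proof -
  define E where "E = (\<lambda>x. \<Sum>a. euler_coeff q a * x ^ a)"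
  have sums: "(\<lambda>a. euler_coeff q a * x ^ a) sums E x" for x
    unfolding E_def by (rule summable_sums[OF summable_norm_cancel[OF summable_euler[OF q]]])
  have rec: "E x = (1 - x) * E (x * q)" for x
  proof -
    have "(\<lambda>a. euler_coeff q a * x ^ a - euler_coeff q a * (x * q) ^ a) sums (E x - E (x * q))"
      by (intro sums_diff sums)
    then have "(\<lambda>a. euler_coeff q (Suc a) * x ^ Suc a - euler_coeff q (Suc a) * (x * q) ^ Suc a)
                 sums (E x - E (x * q))"
      by (rule sums_Suc_zero) simp
    also have "(\<lambda>a. euler_coeff q (Suc a) * x ^ Suc a - euler_coeff q (Suc a) * (x * q) ^ Suc a)
                 = (\<lambda>a. - x * (euler_coeff q a * (x * q) ^ a))"
    proof
      fix a
      have "euler_coeff q (Suc a) * x ^ Suc a - euler_coeff q (Suc a) * (x * q) ^ Suc a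
              = (euler_coeff q (Suc a) * (1 - q ^ Suc a)) * x ^ Suc a"
        by (simp add: algebra_simps power_mult_distrib)
      then show "euler_coeff q (Suc a) * x ^ Suc a - euler_coeff q (Suc a) * (x * q) ^ Suc a
              = - x * (euler_coeff q a * (x * q) ^ a)"
        unfolding euler_coeff_Suc[OF q] by (simp add: power_mult_distrib)
    qed
    finally have "E x - E (x * q) = - x * E (x * q)"
      using sums_unique2 sums_mult[OF sums] by blast
    then show ?thesis by (simp add: algebra_simps)
  qed
  have iter: "E x = qpoch x q n * E (x * q ^ n)" for n
  proof (induction n)
    case (Suc n)
    then show ?case using rec[of "x * q ^ n"] by (simp add: qpoch_Suc mult_ac)
  qed simp
  have "isCont E 0"
    unfolding E_def
    by (rule isCont_powser[of _ 1])
       (use sums[of 1, THEN sums_summable] in auto)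
  moreover have "(\<lambda>n. x * q ^ n) \<longlonglongrightarrow> x * 0"
    by (intro tendsto_intros LIMSEQ_power_zero q)
  ultimately have "(\<lambda>n. E (x * q ^ n)) \<longlonglongrightarrow> E 0"
    by (auto intro: isCont_tendsto_compose)
  moreover have "E 0 = 1"
    unfolding E_def by (subst suminf_finite[of "{0}"]) (auto simp: euler_coeff_def power_0_left)
  ultimately have "(\<lambda>n. qpoch x q n * E (x * q ^ n)) \<longlonglongrightarrow> qpoch_inf x q * 1"
    by (intro tendsto_mult qpoch_tendsto q) simp_all
  then have "E x = qpoch_inf x q"
    unfolding iter[symmetric] by (simp add: LIMSEQ_const_iff)
  then show ?thesis using sums[of x] by simp
qed

section \<open>The infinite product as an entire function of its argument\<close>

lemma uniform_limit_qpoch: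
  fixes q :: complex
  assumes "norm q < 1"
  shows "uniform_limit (cball 0 R) (\<lambda>n V. qpoch V q n) (\<lambda>V. qpoch_inf V q) sequentially"
proof -
  have "uniformly_convergent_on (cball 0 R) (\<lambda>n V. qpoch V q n)"
    unfolding qpoch_def
  proof (rule uniformly_convergent_on_prod')
    show "uniformly_convergent_on (cball 0 R) (\<lambda>N V. \<Sum>n<N. norm (1 - V * q ^ n - 1))"
    proof (rule Weierstrass_m_test')
      show "norm (norm (1 - V * q ^ n - 1)) \<le> R * norm q ^ n" if "V \<in> cball 0 R" for n V
        using that by (auto simp: norm_mult norm_power intro!: mult_right_mono)
      show "summable (\<lambda>n. R * norm q ^ n)"
        using assms by (intro summable_mult summable_geometric) auto
    qed
  qed (auto intro!: continuous_intros)
  then obtain l where l: "uniform_limit (cball 0 R) (\<lambda>n V. qpoch V q n) l sequentially"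
    by (auto simp: uniformly_convergent_on_def)
  have "l V = qpoch_inf V q" if "V \<in> cball 0 R" for V
    using tendsto_uniform_limitI[OF l that] qpoch_tendsto[OF assms, of V] LIMSEQ_unique by blast
  then show ?thesis
    by (intro iffD1[OF uniform_limit_cong' l]) auto
qed

lemma holomorphic_qpoch_inf:
  assumes "norm q < 1"
  shows "(\<lambda>V. qpoch_inf V q) holomorphic_on UNIV"
proof (rule holomorphic_uniform_sequence)
  show "(\<lambda>V. qpoch V q n) holomorphic_on UNIV" for n
    unfolding qpoch_def by (intro holomorphic_intros)
  show "\<exists>d>0. cball x d \<subseteq> UNIV \<and>
      uniform_limit (cball x d) (\<lambda>n V. qpoch V q n) (\<lambda>V. qpoch_inf V q) sequentially" for x
  proof (intro exI[of _ 1] conjI)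
    show "uniform_limit (cball x 1) (\<lambda>n V. qpoch V q n) (\<lambda>V. qpoch_inf V q) sequentially"
    proof (rule uniform_limit_on_subset[OF uniform_limit_qpoch[OF assms, of "norm x + 1"]], rule subsetI)
      fix y assume "y \<in> cball x 1"
      then show "y \<in> cball 0 (norm x + 1)"
        using norm_triangle_sub[of y x] by (simp add: dist_norm norm_minus_commute)
    qed
  qed auto
qed auto

text \<open>The derivative is taken in the argument \<open>V\<close>, not in \<open>q\<close>. At
  \<open>V = q\<close> and \<open>V = - v\<close>, with suitable multipliers, this series becomes
  the Lambert series in \<open>deriv_pell_gf\<close>.\<close>

lemma logderiv_qpoch_inf:
  assumes "norm q < 1" "qpoch_inf V q \<noteq> 0"
  shows "(\<lambda>i. - (q ^ i) / (1 - V * q ^ i)) sums (deriv (\<lambda>V. qpoch_inf V q) V / qpoch_inf V q)"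
proof -
  have "uniform_limit (ball 0 (norm V + 1)) (\<lambda>n V. qpoch V q n) (\<lambda>V. qpoch_inf V q) sequentially"
    by (rule uniform_limit_on_subset[OF uniform_limit_qpoch[OF assms(1)] ball_subset_cball])
  then have "(\<lambda>i. deriv (\<lambda>V. 1 - V * q ^ i) V / (1 - V * q ^ i))
      sums (deriv (\<lambda>V. qpoch_inf V q) V / qpoch_inf V q)"
    unfolding qpoch_def
    by (rule logderiv_prodinf_complex_uniform_limit)
       (use assms in \<open>auto intro!: holomorphic_intros\<close>)
  moreover have "deriv (\<lambda>V. 1 - V * q ^ i) V = - (q ^ i)" for i
    by (auto intro!: DERIV_imp_deriv derivative_eq_intros)
  ultimately show ?thesis by simp
qed

section \<open>Lebesgue's identity\<close>

definition lebesgue_term :: "complex \<Rightarrow> complex \<Rightarrow> nat \<Rightarrow> complex" where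
  "lebesgue_term q z n = qpoch (- z) q n * q ^ (n * (n + 1) div 2) / qpoch q q n"

lemma lebesgue_term_Suc:
  "lebesgue_term q z (Suc n) =
     lebesgue_term q z n * ((1 + z * q ^ n) * q ^ Suc n / (1 - q ^ Suc n))"
  unfolding lebesgue_term_def triangular_Suc by (simp add: qpoch_Suc power_add mult_ac)

lemma norm_lebesgue_term_Suc:
  assumes "norm q < 1"
  shows "norm (lebesgue_term q z (Suc n))
          \<le> (1 + norm z) / (1 - norm q) * norm q ^ n * norm (lebesgue_term q z n)"
proof -
  have "norm (z * q ^ n) \<le> norm z * 1"
    unfolding norm_mult norm_power using assms by (intro mult_left_mono power_le_one) auto
  then have 1: "norm (1 + z * q ^ n) \<le> 1 + norm z"
    using norm_triangle_ineq[of 1 "z * q ^ n"] by simp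
  have 2: "norm (q ^ Suc n) \<le> norm q ^ n"
    unfolding norm_power using assms by (intro power_decreasing) auto
  have 3: "1 / norm (1 - q ^ Suc n) \<le> 1 / (1 - norm q)"
    using assms norm_one_minus_power_ge[OF assms, of n] by (intro divide_left_mono) (auto intro!: mult_pos_pos)
  have "norm ((1 + z * q ^ n) * q ^ Suc n / (1 - q ^ Suc n))
          = norm (1 + z * q ^ n) * norm (q ^ Suc n) * (1 / norm (1 - q ^ Suc n))"
    by (simp add: norm_mult norm_divide)
  also have "\<dots> \<le> (1 + norm z) * norm q ^ n * (1 / (1 - norm q))"
    by (intro mult_mono 1 2 3) (auto intro!: add_nonneg_nonneg)
  finally have "norm (lebesgue_term q z n) * norm ((1 + z * q ^ n) * q ^ Suc n / (1 - q ^ Suc n))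
      \<le> norm (lebesgue_term q z n) * ((1 + norm z) * norm q ^ n * (1 / (1 - norm q)))"
    by (intro mult_left_mono) auto
  then show ?thesis
    unfolding lebesgue_term_Suc norm_mult by (simp add: mult_ac)
qed

text \<open>Besides the series \<open>L\<close>, the series \<open>M\<close> with an extra factor
  \<open>q ^ n\<close> is used. Two contiguous relations between them yield
  \<open>L z = (1 + z * q) * L (z * q ^ 2)\<close>; iteration produces the product in base
  \<open>q ^ 2\<close> and leaves \<open>L 0\<close>, which is Euler's expansion.\<close>

lemma lebesgue_identity:
  assumes q: "norm q < 1"
  shows "lebesgue_term q z sums (qpoch_inf (- z * q) (q ^ 2) * qpoch_inf (- q) q)"
proof -
  define L where "L = (\<lambda>z. \<Sum>n. lebesgue_term q z n)"
  define M where "M = (\<lambda>z. \<Sum>n. lebesgue_term q z n * q ^ n)"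
  have sumL: "summable (\<lambda>n. norm (lebesgue_term q z n))" for z
    by (rule summable_norm_superexponential[OF norm_lebesgue_term_Suc[OF q]]) (use q in auto)
  have L: "lebesgue_term q z sums L z" for z
    unfolding L_def by (rule summable_sums[OF summable_norm_cancel[OF sumL]])
  have M: "(\<lambda>n. lebesgue_term q z n * q ^ n) sums M z" for z
    unfolding M_def
  proof (rule summable_sums, rule summable_comparison_test'[OF sumL])
    show "norm (lebesgue_term q z n * q ^ n) \<le> norm (lebesgue_term q z n)" for n
      unfolding norm_mult norm_power using q by (intro mult_right_le_one_le power_le_one) auto
  qed
  have nz: "1 - q ^ Suc n \<noteq> 0" "qpoch q q n \<noteq> 0" for n
    using qpoch_nonzero[OF q q, of "Suc n"] by (auto simp: qpoch_Suc)
  have LL: "L z = L (z * q) + z * q * M (z * q)" for z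
  proof -
    have "(\<lambda>n. lebesgue_term q z n - lebesgue_term q (z * q) n) sums (L z - L (z * q))"
      by (intro sums_diff L)
    then have "(\<lambda>n. lebesgue_term q z (Suc n) - lebesgue_term q (z * q) (Suc n)) sums (L z - L (z * q))"
      by (rule sums_Suc_zero) (simp add: lebesgue_term_def)
    moreover have "lebesgue_term q z (Suc n) - lebesgue_term q (z * q) (Suc n)
        = z * q * (lebesgue_term q (z * q) n * q ^ n)" for n
    proof -
      \<comment> \<open>Both terms are multiples of \<open>X\<close>: in the first, the factor
        \<open>1 + z\<close> is split off at the front of the Pochhammer symbol, in the second,
        \<open>1 + z * q ^ Suc n\<close> at its end.\<close>
      define X where "X = qpoch (- (z * q)) q n * q ^ (n * (n + 1) div 2) * q ^ Suc n / qpoch q q n"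
      have "lebesgue_term q z (Suc n) = (1 + z) * X / (1 - q ^ Suc n)"
        unfolding lebesgue_term_def triangular_Suc qpoch_Suc_shift[of "- z"] qpoch_Suc[of q] X_def
        by (simp add: power_add mult_ac)
      moreover have "lebesgue_term q (z * q) (Suc n) = (1 + z * q ^ Suc n) * X / (1 - q ^ Suc n)"
        unfolding lebesgue_term_def triangular_Suc qpoch_Suc X_def
        by (simp add: power_add mult_ac)
      ultimately have "lebesgue_term q z (Suc n) - lebesgue_term q (z * q) (Suc n)
          = ((1 + z) * X - (1 + z * q ^ Suc n) * X) / (1 - q ^ Suc n)"
        by (simp only: diff_divide_distrib)
      also have "(1 + z) * X - (1 + z * q ^ Suc n) * X = z * X * (1 - q ^ Suc n)"
        by (simp add: algebra_simps)
      finally have "lebesgue_term q z (Suc n) - lebesgue_term q (z * q) (Suc n) = z * X"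
        using nz(1)[of n] by simp
      then show ?thesis by (simp add: X_def lebesgue_term_def mult_ac)
    qed
    ultimately have "(\<lambda>n. z * q * (lebesgue_term q (z * q) n * q ^ n)) sums (L z - L (z * q))"
      by simp
    moreover have "(\<lambda>n. z * q * (lebesgue_term q (z * q) n * q ^ n)) sums (z * q * M (z * q))"
      by (intro sums_mult M)
    ultimately have "L z - L (z * q) = z * q * M (z * q)" by (rule sums_unique2)
    then show ?thesis by (simp add: algebra_simps)
  qed
  have LM: "L z = M z + q * (1 + z) * M (z * q)" for z
  proof -
    have "(\<lambda>n. lebesgue_term q z n - lebesgue_term q z n * q ^ n) sums (L z - M z)"
      by (intro sums_diff L M)
    then have "(\<lambda>n. lebesgue_term q z (Suc n) - lebesgue_term q z (Suc n) * q ^ Suc n) sums (L z - M z)"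
      by (rule sums_Suc_zero) (simp add: lebesgue_term_def)
    moreover have "lebesgue_term q z (Suc n) - lebesgue_term q z (Suc n) * q ^ Suc n
        = q * (1 + z) * (lebesgue_term q (z * q) n * q ^ n)" for n
    proof -
      define X where "X = qpoch (- (z * q)) q n * q ^ (n * (n + 1) div 2) * q ^ Suc n / qpoch q q n"
      have "lebesgue_term q z (Suc n) = (1 + z) * X / (1 - q ^ Suc n)"
        unfolding lebesgue_term_def triangular_Suc qpoch_Suc_shift[of "- z"] qpoch_Suc[of q] X_def
        by (simp add: power_add mult_ac)
      moreover have "lebesgue_term q z (Suc n) - lebesgue_term q z (Suc n) * q ^ Suc n
          = lebesgue_term q z (Suc n) * (1 - q ^ Suc n)"
        by (simp add: algebra_simps)
      ultimately have "lebesgue_term q z (Suc n) - lebesgue_term q z (Suc n) * q ^ Suc n = (1 + z) * X"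
        using nz(1)[of n] by simp
      then show ?thesis by (simp add: X_def lebesgue_term_def mult_ac)
    qed
    ultimately have "(\<lambda>n. q * (1 + z) * (lebesgue_term q (z * q) n * q ^ n)) sums (L z - M z)"
      by simp
    moreover have "(\<lambda>n. q * (1 + z) * (lebesgue_term q (z * q) n * q ^ n)) sums (q * (1 + z) * M (z * q))"
      by (intro sums_mult M)
    ultimately have "L z - M z = q * (1 + z) * M (z * q)" by (rule sums_unique2)
    then show ?thesis by (simp add: algebra_simps)
  qed
  \<comment> \<open>Eliminate \<open>M (z * q)\<close> and \<open>M (z * q ^ 2)\<close> from
    \<open>LL\<close> at \<open>z\<close> and \<open>z * q\<close> and \<open>LM\<close> at
    \<open>z * q\<close>.\<close>
  have rec: "L z = (1 + z * q) * L (z * q ^ 2)" for z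
  proof -
    have "z * q ^ 2 = z * q * q" by (simp add: power2_eq_square)
    then show ?thesis
      using LL[of z] LL[of "z * q"] LM[of "z * q"] by algebra
  qed
  have iter: "L z = qpoch (- z * q) (q ^ 2) n * L (z * (q ^ 2) ^ n)" for n
  proof (induction n)
    case (Suc n)
    then show ?case using rec[of "z * (q ^ 2) ^ n"] by (simp add: qpoch_Suc mult_ac)
  qed simp
  have q2: "norm (q ^ 2) < 1" using q by (simp add: norm_power power_less_one_iff)
  \<comment> \<open>Only continuity at 0 is wanted. On the unit ball
    \<open>1 + norm z \<le> 2\<close>, which frees the ratio bound from \<open>z\<close>.\<close>
  have "L holomorphic_on ball 0 1"
    unfolding L_def
  proof (rule holomorphic_on_suminf_superexponential)
    fix n and z :: complex assume "z \<in> ball 0 1"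
    then have "(1 + norm z) / (1 - norm q) * norm q ^ n * norm (lebesgue_term q z n)
        \<le> 2 / (1 - norm q) * norm q ^ n * norm (lebesgue_term q z n)"
      using q by (intro mult_right_mono divide_right_mono) auto
    with norm_lebesgue_term_Suc[OF q, of z n]
    show "norm (lebesgue_term q z (Suc n)) \<le> 2 / (1 - norm q) * norm q ^ n * norm (lebesgue_term q z n)"
      by linarith
  next
    show "(\<lambda>z. lebesgue_term q z n) holomorphic_on ball 0 1" for n
      unfolding lebesgue_term_def qpoch_def[of "- _"]
      by (intro holomorphic_intros) (use nz in auto)
  next
    show "norm (lebesgue_term q z 0) \<le> 1" for z by (simp add: lebesgue_term_def)
  qed (use q in auto)
  then have "isCont L 0"
    by (meson centre_in_ball continuous_on_eq_continuous_at holomorphic_on_imp_continuous_on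
        open_ball zero_less_one)
  moreover have "(\<lambda>n. z * (q ^ 2) ^ n) \<longlonglongrightarrow> z * 0"
    by (intro tendsto_intros LIMSEQ_power_zero q2)
  ultimately have "(\<lambda>n. L (z * (q ^ 2) ^ n)) \<longlonglongrightarrow> L 0"
    by (auto intro: isCont_tendsto_compose)
  then have "(\<lambda>n. qpoch (- z * q) (q ^ 2) n * L (z * (q ^ 2) ^ n))
               \<longlonglongrightarrow> qpoch_inf (- z * q) (q ^ 2) * L 0"
    by (intro tendsto_mult qpoch_tendsto q2)
  then have "L z = qpoch_inf (- z * q) (q ^ 2) * L 0"
    unfolding iter[symmetric] by (simp add: LIMSEQ_const_iff)
  moreover have "L 0 = qpoch_inf (- q) q"
  proof -
    have "lebesgue_term q 0 n = euler_coeff q n * (- q) ^ n" for n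
    proof -
      have "n * (n + 1) div 2 = n * (n - 1) div 2 + n"
        using choose_two_Suc[of n] by (simp add: mult.commute)
      moreover have "(- 1) ^ n * (- q) ^ n = q ^ n"
        by (simp flip: power_mult_distrib)
      moreover have "qpoch (- 0) q n = 1"
        by (simp add: qpoch_def)
      ultimately show ?thesis
        unfolding lebesgue_term_def euler_coeff_def by (simp add: power_add mult_ac)
    qed
    then have "lebesgue_term q 0 = (\<lambda>n. euler_coeff q n * (- q) ^ n)" by blast
    then show ?thesis
      using L[of 0] euler_qpoch_inf[OF q, of "- q"] by (simp add: sums_unique2)
  qed
  ultimately show ?thesis using L[of z] by simp
qed

section \<open>The Lambert series over odd exponents\<close>

lemma summable_on_Times_mult:
  fixes f :: "'a \<Rightarrow> real" and g :: "'b \<Rightarrow> real"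
  assumes f: "f summable_on A" and g: "g summable_on B"
    and "\<And>x. x \<in> A \<Longrightarrow> f x \<ge> 0" "\<And>y. y \<in> B \<Longrightarrow> g y \<ge> 0"
  shows "(\<lambda>(x, y). f x * g y) summable_on A \<times> B"
proof (rule summable_on_SigmaI)
  show "((\<lambda>y. case (x, y) of (x, y) \<Rightarrow> f x * g y) has_sum (f x * infsum g B)) B" for x
    using has_sum_cmult_right[OF has_sum_infsum[OF g]] by simp
  show "(\<lambda>x. f x * infsum g B) summable_on A"
    by (intro summable_on_cmult_left f)
qed (use assms in auto)

text \<open>The double series of \<open>2 * q ^ (Suc i * (2 * k + 1))\<close> is summed in both
  orders. With \<open>x = q ^ Suc i\<close>, row \<open>i\<close> is
  \<open>x / (1 - x) + x / (1 + x)\<close>, in which the even powers of \<open>x\<close> cancel;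
  column \<open>k\<close> is geometric in \<open>i\<close>.\<close>

lemma lambert_odd:
  fixes q :: complex
  assumes q: "norm q < 1"
  shows "(\<lambda>i. q ^ Suc i / (1 - q ^ Suc i) + q ^ Suc i / (1 + q ^ Suc i))
           sums (2 * (\<Sum>n. q ^ (2 * (n + 1) - 1) / (1 - q ^ (2 * (n + 1) - 1))))"
proof -
  define f where "f = (\<lambda>(i, k). 2 * q ^ (Suc i * (2 * k + 1)))"
  have lt: "norm (q ^ Suc i) < 1" for i
    unfolding norm_power using q by (subst power_less_one_iff) auto
  have nz: "1 - q ^ Suc i \<noteq> 0" "1 + q ^ Suc i \<noteq> 0" for i
  proof -
    show "1 - q ^ Suc i \<noteq> 0" using lt[of i] by (metis eq_iff_diff_eq_0 norm_one order_less_irrefl)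
    show "1 + q ^ Suc i \<noteq> 0"
      using lt[of i] by (metis add.inverse_unique norm_minus_cancel norm_one order_less_irrefl)
  qed
  have row: "((\<lambda>k. f (i, k)) has_sum (q ^ Suc i / (1 - q ^ Suc i) + q ^ Suc i / (1 + q ^ Suc i))) UNIV" for i
  proof -
    define x where "x = q ^ Suc i"
    have x: "norm x < 1" unfolding x_def by (rule lt)
    then have x2: "norm (x ^ 2) < 1" by (simp add: norm_power power_less_one_iff)
    have "((\<lambda>k. (x ^ 2) ^ k) has_sum (1 / (1 - x ^ 2))) UNIV"
      using x2 by (intro norm_summable_imp_has_sum geometric_sums)
                  (auto simp: norm_power intro!: summable_geometric)
    then have "((\<lambda>k. 2 * x * (x ^ 2) ^ k) has_sum (2 * x * (1 / (1 - x ^ 2)))) UNIV"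
      by (rule has_sum_cmult_right)
    moreover have "2 * x * (1 / (1 - x ^ 2)) = x / (1 - x) + x / (1 + x)"
    proof -
      have "1 - x ^ 2 = (1 - x) * (1 + x)" by (simp add: power2_eq_square algebra_simps)
      moreover have "1 - x \<noteq> 0" "1 + x \<noteq> 0" using nz[of i] by (simp_all add: x_def)
      ultimately show ?thesis by (simp add: field_simps)
    qed
    moreover have "f (i, k) = 2 * x * (x ^ 2) ^ k" for k
      by (simp add: f_def x_def power_mult[symmetric] power_add[symmetric] algebra_simps)
    ultimately show ?thesis by (simp add: x_def)
  qed
  have col: "((\<lambda>i. f (i, k)) has_sum (2 * (q ^ (2 * (k + 1) - 1) / (1 - q ^ (2 * (k + 1) - 1))))) UNIV" for k
  proof -
    define x where "x = q ^ Suc (2 * k)"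
    have x: "norm x < 1" unfolding x_def by (rule lt)
    have "((\<lambda>i. x ^ i) has_sum (1 / (1 - x))) UNIV"
      using x by (intro norm_summable_imp_has_sum geometric_sums)
                  (auto simp: norm_power intro!: summable_geometric)
    then have "((\<lambda>i. 2 * x * x ^ i) has_sum (2 * x * (1 / (1 - x)))) UNIV"
      by (rule has_sum_cmult_right)
    moreover have "f (i, k) = 2 * x * x ^ i" for i
      by (simp add: f_def x_def power_mult[symmetric] power_add[symmetric] algebra_simps)
    ultimately show ?thesis by (simp add: x_def)
  qed
  have geo: "(\<lambda>i. norm q ^ i) summable_on UNIV"
    using q by (intro norm_summable_imp_summable_on) (auto simp: norm_power intro!: summable_geometric)
  have abs: "(\<lambda>x. norm (f x)) summable_on UNIV"
  proof (rule Infinite_Sum.abs_summable_on_comparison_test')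
    have "(\<lambda>(i, k). (norm q ^ i) * (norm q ^ k)) summable_on UNIV \<times> UNIV"
      by (rule summable_on_Times_mult) (use geo in auto)
    then show "(\<lambda>(i, k). 2 * (norm q ^ i * norm q ^ k)) summable_on (UNIV :: (nat \<times> nat) set)"
      using summable_on_cmult_right[of _ _ "2 :: real"] by (auto simp: case_prod_unfold)
    show "norm (f x) \<le> (case x of (i, k) \<Rightarrow> 2 * (norm q ^ i * norm q ^ k))" for x
    proof (cases x)
      case (Pair i k)
      have "norm q ^ (Suc i * (2 * k + 1)) \<le> norm q ^ (i + k)"
        using q by (intro power_decreasing) auto
      then show ?thesis by (simp add: Pair f_def norm_mult norm_power power_add)
    qed
  qed
  have sm: "f summable_on UNIV \<times> UNIV"
    using abs_summable_summable[OF abs] by simp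
  define S where "S = infsum f (UNIV \<times> UNIV)"
  have S: "(f has_sum S) (UNIV \<times> UNIV)"
    unfolding S_def using sm by (rule has_sum_infsum)
  have "((\<lambda>(k, i). f (i, k)) has_sum S) (UNIV \<times> UNIV)"
    using S by (subst has_sum_swap) (simp add: case_prod_unfold)
  then have "((\<lambda>k. 2 * (q ^ (2 * (k + 1) - 1) / (1 - q ^ (2 * (k + 1) - 1)))) has_sum S) UNIV"
    by (rule has_sum_SigmaD) (use col in simp)
  then have "(\<lambda>k. 2 * (q ^ (2 * (k + 1) - 1) / (1 - q ^ (2 * (k + 1) - 1)))) sums S"
    by (rule has_sum_imp_sums)
  from sums_divide[OF this, of 2]
  have sumsS: "(\<lambda>k. q ^ (2 * (k + 1) - 1) / (1 - q ^ (2 * (k + 1) - 1))) sums (S / 2)"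
    by (simp only: nonzero_mult_div_cancel_left[OF zero_neq_numeral[symmetric]])
  have "((\<lambda>i. q ^ Suc i / (1 - q ^ Suc i) + q ^ Suc i / (1 + q ^ Suc i)) has_sum S) UNIV"
    using S row by (rule has_sum_SigmaD)
  then have "(\<lambda>i. q ^ Suc i / (1 - q ^ Suc i) + q ^ Suc i / (1 + q ^ Suc i)) sums S"
    by (rule has_sum_imp_sums)
  then show ?thesis unfolding sums_unique[OF sumsS, symmetric] by simp
qed

section \<open>Gaussian binomial coefficients and their generating functions\<close>

lemma qbinomial_eq_0 [simp]: "n < k \<Longrightarrow> qbinomial q n k = 0"
  by (simp add: qbinomial_def)

lemma qbinomial_0_right [simp]: "norm q < 1 \<Longrightarrow> qbinomial q n 0 = 1"
  using qpoch_nonzero[of q q n] by (simp add: qbinomial_def)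

lemma qbinomial_pascal:
  assumes "norm q < 1"
  shows "qbinomial q (Suc n) (Suc k) = q ^ Suc k * qbinomial q n (Suc k) + qbinomial q n k"
proof -
  have nz: "qpoch q q m \<noteq> 0" for m by (intro qpoch_nonzero assms)
  have S: "qpoch q q (Suc m) = qpoch q q m * (1 - q ^ Suc m)" for m
    by (simp add: qpoch_Suc)
  have nz': "1 - q ^ Suc m \<noteq> 0" for m
    using nz[of "Suc m"] by (auto simp: S)
  consider "k < n" | "k = n" | "n < k" by linarith
  then show ?thesis
  proof cases
    case 1
    then obtain d where d: "n = k + Suc d" by (metis less_iff_Suc_add add_Suc_right)
    \<comment> \<open>Over the common denominator in \<open>X\<close>, Pascal's rule reduces to the
      identity \<open>b4\<close> between the three remaining factors.\<close>
    define X where "X = qpoch q q n / (qpoch q q k * qpoch q q d * (1 - q ^ Suc k) * (1 - q ^ Suc d))"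
    have b1: "qbinomial q (Suc n) (Suc k) = X * (1 - q ^ Suc n)"
      unfolding X_def qbinomial_def S d by (simp add: S mult_ac)
    have b2: "qbinomial q n (Suc k) = X * (1 - q ^ Suc d)"
      unfolding X_def qbinomial_def d using nz'[of d] by (simp add: S mult_ac)
    have b3: "qbinomial q n k = X * (1 - q ^ Suc k)"
      unfolding X_def qbinomial_def d using nz'[of k] by (simp add: S mult_ac)
    have b4: "1 - q ^ Suc n = q ^ Suc k * (1 - q ^ Suc d) + (1 - q ^ Suc k)"
      by (simp add: d power_add algebra_simps)
    show ?thesis unfolding b1 b2 b3 b4 by (simp only: distrib_left mult.left_commute)
  qed (use nz in \<open>auto simp: qbinomial_def\<close>)
qed

text \<open>The Pochhammer symbols converge to a nonzero limit, so they and their reciprocals are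
  bounded.\<close>

lemma qbinomial_bounded:
  assumes "norm q < 1"
  obtains K where "K > 0" "\<And>n k. norm (qbinomial q n k) \<le> K"
proof -
  obtain A where A: "A > 0" "\<And>n. norm (qpoch q q n) \<le> A"
    using qpoch_bounded[OF assms] by metis
  obtain B where B: "B > 0" "\<And>n. norm (1 / qpoch q q n) \<le> B"
    using qpoch_inverse_bounded[OF assms assms] by metis
  have "norm (qbinomial q n k) \<le> A * (B * B)" for n k
  proof (cases "k \<le> n")
    case True
    then have "norm (qbinomial q n k)
        = norm (qpoch q q n) * (norm (1 / qpoch q q k) * norm (1 / qpoch q q (n - k)))"
      by (simp add: qbinomial_def norm_mult norm_divide)
    also have "\<dots> \<le> A * (B * B)"
      using A B by (intro mult_mono) auto
    finally show ?thesis .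
  qed (use A B in auto)
  then show ?thesis using that[of "A * (B * B)"] A B by simp
qed

text \<open>Pascal's rule splits each coefficient into two terms of the same sum at
  \<open>x * q\<close>, so the induction has to range over all \<open>x\<close>. The outcome is the
  factor \<open>1 + x\<close> that leads the longer product.\<close>

lemma q_binomial_theorem:
  assumes "norm q < 1"
  shows "(\<Sum>k\<le>j. qbinomial q j k * q ^ (k * (k - 1) div 2) * x ^ k) = qpoch (- x) q j"
proof (induction j arbitrary: x)
  case 0
  then show ?case by (simp add: assms)
next
  case (Suc j)
  define a where "a = (\<lambda>k. qbinomial q j k * q ^ (k * (k - 1) div 2) * (x * q) ^ k)"
  have a: "(\<Sum>k\<le>j. a k) = qpoch (- (x * q)) q j"
    using Suc[of "x * q"] by (simp add: a_def)
  have "(\<Sum>k\<le>Suc j. qbinomial q (Suc j) k * q ^ (k * (k - 1) div 2) * x ^ k)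
      = 1 + (\<Sum>k\<le>j. qbinomial q (Suc j) (Suc k) * q ^ (Suc k * (Suc k - 1) div 2) * x ^ Suc k)"
    by (subst sum.atMost_Suc_shift) (simp add: assms)
  also have "(\<Sum>k\<le>j. qbinomial q (Suc j) (Suc k) * q ^ (Suc k * (Suc k - 1) div 2) * x ^ Suc k)
      = (\<Sum>k\<le>j. a (Suc k) + x * a k)"
  proof (intro sum.cong refl)
    fix k
    show "qbinomial q (Suc j) (Suc k) * q ^ (Suc k * (Suc k - 1) div 2) * x ^ Suc k = a (Suc k) + x * a k"
      unfolding a_def qbinomial_pascal[OF assms] choose_two_Suc
      by (simp add: power_add power_mult_distrib algebra_simps)
  qed
  also have "1 + (\<Sum>k\<le>j. a (Suc k) + x * a k) = (a 0 + (\<Sum>k\<le>j. a (Suc k))) + x * (\<Sum>k\<le>j. a k)"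
    by (simp add: sum.distrib sum_distrib_left a_def assms)
  also have "a 0 + (\<Sum>k\<le>j. a (Suc k)) = (\<Sum>k\<le>Suc j. a k)"
    by (rule sum.atMost_Suc_shift[symmetric])
  also have "\<dots> = (\<Sum>k\<le>j. a k)"
    by (simp add: a_def)
  also have "(\<Sum>k\<le>j. a k) + x * (\<Sum>k\<le>j. a k) = qpoch (- x) q (Suc j)"
    unfolding a qpoch_Suc_shift by (simp add: algebra_simps)
  finally show ?case .
qed

lemma summable_qbinomial_geometric:
  assumes "norm q < 1" "norm t < 1"
  shows "summable (\<lambda>m. norm (qbinomial q (f m) (g m) * t ^ m))"
proof -
  obtain K where K: "K > 0" "\<And>n k. norm (qbinomial q n k) \<le> K"
    using qbinomial_bounded[OF assms(1)] by metis
  show ?thesis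
  proof (rule summable_comparison_test')
    show "summable (\<lambda>m. K * norm t ^ m)"
      using assms by (intro summable_mult summable_geometric) auto
    show "norm (norm (qbinomial q (f m) (g m) * t ^ m)) \<le> K * norm t ^ m" for m
      using K by (auto simp: norm_mult norm_power intro!: mult_right_mono)
  qed
qed

text \<open>The \<open>q\<close>-analogue of the negative binomial series. Pascal's rule relates the
  sum \<open>P\<close> to itself: \<open>P * (1 - t * q ^ Suc j)\<close> is the sum for
  \<open>j\<close>.\<close>

lemma qbinomial_negative_sums:
  assumes q: "norm q < 1" and t: "norm t < 1"
  shows "(\<lambda>m. qbinomial q (m + j) j * t ^ m) sums (1 / qpoch t q (Suc j))"
proof (induction j)
  case 0
  then show ?case using geometric_sums[OF t] q by (simp add: qpoch_Suc)
next
  case (Suc j)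
  define P where "P = (\<Sum>m. qbinomial q (m + Suc j) (Suc j) * t ^ m)"
  have P: "(\<lambda>m. qbinomial q (m + Suc j) (Suc j) * t ^ m) sums P"
    unfolding P_def by (rule summable_sums[OF summable_norm_cancel[OF summable_qbinomial_geometric[OF q t]]])
  have "(\<lambda>m. qbinomial q (Suc m + j) (Suc j) * t ^ Suc m) sums (t * P)"
    using sums_mult[OF P, of t] by (simp add: mult_ac)
  \<comment> \<open>The added term at index 0 vanishes because \<open>qbinomial q j (Suc j)\<close>
    is 0.\<close>
  then have "(\<lambda>m. qbinomial q (m + j) (Suc j) * t ^ m) sums (t * P)"
    using sums_Suc_iff[of "\<lambda>m. qbinomial q (m + j) (Suc j) * t ^ m" "t * P"] by simp
  from sums_add[OF sums_mult[OF this, of "q ^ Suc j"] Suc]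
  have "(\<lambda>m. q ^ Suc j * (qbinomial q (m + j) (Suc j) * t ^ m) + qbinomial q (m + j) j * t ^ m)
          sums (q ^ Suc j * (t * P) + 1 / qpoch t q (Suc j))" .
  also have "(\<lambda>m. q ^ Suc j * (qbinomial q (m + j) (Suc j) * t ^ m) + qbinomial q (m + j) j * t ^ m)
      = (\<lambda>m. qbinomial q (m + Suc j) (Suc j) * t ^ m)"
    using qbinomial_pascal[OF q] by (simp add: algebra_simps)
  finally have "P = q ^ Suc j * (t * P) + 1 / qpoch t q (Suc j)"
    by (rule sums_unique2[OF P])
  then have "P * (1 - t * q ^ Suc j) = 1 / qpoch t q (Suc j)"
    by (simp add: algebra_simps)
  moreover have "1 - t * q ^ Suc j \<noteq> 0"
    using qpoch_nonzero[OF q t, of "Suc (Suc j)"] by (auto simp: qpoch_Suc)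
  ultimately have "P = 1 / qpoch t q (Suc j) / (1 - t * q ^ Suc j)"
    by (metis nonzero_eq_divide_eq)
  then have "P = 1 / qpoch t q (Suc (Suc j))"
    unfolding qpoch_Suc[of t q "Suc j"] by simp
  then show ?case using P by simp
qed

lemma qbinomial_shifted_sums:
  assumes q: "norm q < 1" and t: "norm t < 1" and "k \<le> j"
  shows "(\<lambda>n. qbinomial q (n - k) j * t ^ n) sums (t ^ (j + k) / qpoch t q (Suc j))"
proof -
  define f where "f = (\<lambda>n. qbinomial q (n - k) j * t ^ n)"
  have "f n = 0" if "n < j + k" for n
  proof -
    \<comment> \<open>This includes \<open>n < k\<close>, where the truncated difference is 0, while
      \<open>j \<ge> k > 0\<close>.\<close>
    have "n - k < j" using that \<open>k \<le> j\<close> by linarith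
    then show ?thesis by (simp add: f_def)
  qed
  then have z: "(\<Sum>n<j + k. f n) = 0" by simp
  have "(\<lambda>m. t ^ (j + k) * (qbinomial q (m + j) j * t ^ m)) sums (t ^ (j + k) * (1 / qpoch t q (Suc j)))"
    by (intro sums_mult qbinomial_negative_sums q t)
  then have "(\<lambda>m. f (m + (j + k))) sums (t ^ (j + k) / qpoch t q (Suc j))"
    by (simp add: f_def power_add mult_ac)
  then have "f sums (t ^ (j + k) / qpoch t q (Suc j))"
    unfolding sums_iff_shift[of f "j + k"] z by simp
  then show ?thesis by (simp add: f_def)
qed

section \<open>The generating function of the q-Pell sequences\<close>

text \<open>One family for both sequences: \<open>w = q\<close> turns the exponent
  \<open>k * (k - 1) div 2\<close> into \<open>k * (k + 1) div 2\<close> and gives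
  \<open>qpell_omega\<close>; \<open>w = 1\<close> gives \<open>qpell_Theta\<close>.\<close>

definition pell_coeff :: "complex \<Rightarrow> complex \<Rightarrow> nat \<Rightarrow> complex" where
  "pell_coeff q w n = (\<Sum>j=0..n. \<Sum>k=0..j. qbinomial q j k * qbinomial q (n - k) j *
     q ^ (j * (j + 1) div 2) * q ^ (k * (k - 1) div 2) * w ^ k)"

text \<open>A summand of the generating function without the factor \<open>1 / (1 - t)\<close>: the
  denominator \<open>qpoch t q (Suc j)\<close> is replaced by \<open>qpoch (t * q) q j\<close>,
  which removes the pole at \<open>t = 1\<close>.\<close>

definition pell_term :: "complex \<Rightarrow> complex \<Rightarrow> complex \<Rightarrow> nat \<Rightarrow> complex" where
  "pell_term q w t j = qpoch (- (t * w)) q j * t ^ j * q ^ (j * (j + 1) div 2) / qpoch (t * q) q j"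

definition pell_gf :: "complex \<Rightarrow> complex \<Rightarrow> complex \<Rightarrow> complex" where
  "pell_gf q w t = (\<Sum>j. pell_term q w t j)"

lemma qpell_omega_eq: "qpell_omega n q = pell_coeff q q n"
proof -
  have "k * (k + 1) div 2 = k * (k - 1) div 2 + k" for k :: nat
    using choose_two_Suc[of k] by (simp add: mult.commute)
  then show ?thesis
    unfolding qpell_omega_def pell_coeff_def by (simp add: power_add mult_ac)
qed

lemma qpell_Theta_eq: "qpell_Theta n q = pell_coeff q 1 n"
  unfolding qpell_Theta_def pell_coeff_def by (simp add: power_add mult_ac)

lemma pell_term_Suc:
  "pell_term q w t (Suc j)
     = pell_term q w t j * ((1 + t * w * q ^ j) * (t * q ^ Suc j) / (1 - t * q ^ Suc j))"
  unfolding pell_term_def triangular_Suc by (simp add: qpoch_Suc power_add mult_ac)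

lemma norm_pell_term_Suc:
  assumes "norm q < 1" "norm w \<le> 1" "norm t \<le> \<rho>" "\<rho> * norm q < 1"
  shows "norm (pell_term q w t (Suc j))
           \<le> (1 + \<rho>) * \<rho> / (1 - \<rho> * norm q) * norm q ^ j * norm (pell_term q w t j)"
proof -
  have \<rho>: "\<rho> \<ge> 0" using assms(3) norm_ge_zero order_trans by blast
  have "norm (t * w * q ^ j) \<le> \<rho> * 1 * 1"
    unfolding norm_mult norm_power using assms \<rho> by (intro mult_mono power_le_one) auto
  then have 1: "norm (1 + t * w * q ^ j) \<le> 1 + \<rho>"
    using norm_triangle_ineq[of 1 "t * w * q ^ j"] by simp
  have 2: "norm (t * q ^ Suc j) \<le> \<rho> * norm q ^ j"
    unfolding norm_mult norm_power using assms \<rho> by (intro mult_mono power_decreasing) auto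
  have "norm (t * q ^ Suc j) \<le> \<rho> * norm q ^ 1"
    unfolding norm_mult norm_power using assms \<rho> by (intro mult_mono power_decreasing) auto
  then have "1 - \<rho> * norm q \<le> norm (1 - t * q ^ Suc j)"
    using norm_triangle_ineq2[of 1 "t * q ^ Suc j"] by simp
  then have 3: "1 / norm (1 - t * q ^ Suc j) \<le> 1 / (1 - \<rho> * norm q)"
    using assms by (intro divide_left_mono) (auto intro!: mult_pos_pos)
  have "norm ((1 + t * w * q ^ j) * (t * q ^ Suc j) / (1 - t * q ^ Suc j))
      = norm (1 + t * w * q ^ j) * norm (t * q ^ Suc j) * (1 / norm (1 - t * q ^ Suc j))"
    by (simp add: norm_mult norm_divide)
  also have "\<dots> \<le> (1 + \<rho>) * (\<rho> * norm q ^ j) * (1 / (1 - \<rho> * norm q))"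
    using \<rho> by (intro mult_mono 1 2 3) auto
  finally have "norm (pell_term q w t j) * norm ((1 + t * w * q ^ j) * (t * q ^ Suc j) / (1 - t * q ^ Suc j))
      \<le> norm (pell_term q w t j) * ((1 + \<rho>) * (\<rho> * norm q ^ j) * (1 / (1 - \<rho> * norm q)))"
    by (intro mult_left_mono) auto
  then show ?thesis
    unfolding pell_term_Suc norm_mult by (simp add: mult_ac)
qed

lemma summable_pell_term:
  assumes "norm q < 1" "norm w \<le> 1" "norm t * norm q < 1"
  shows "summable (\<lambda>j. norm (pell_term q w t j))"
  by (rule summable_norm_superexponential[OF norm_pell_term_Suc[OF assms(1,2) order_refl assms(3)]])
     (use assms in auto)

lemma pell_gf_sums:
  assumes "norm q < 1" "norm w \<le> 1" "norm t * norm q < 1"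
  shows "pell_term q w t sums pell_gf q w t"
  unfolding pell_gf_def by (rule summable_sums[OF summable_norm_cancel[OF summable_pell_term[OF assms]]])

text \<open>On the disc all denominators \<open>1 - t * q ^ Suc j\<close> stay at distance at least
  \<open>1 - \<rho> * norm q\<close> from 0, so the ratio bound is uniform. Since
  \<open>\<rho>\<close> may be any number below \<open>1 / norm q\<close>, the disc can contain the
  point 1.\<close>

lemma holomorphic_pell_gf:
  assumes q: "norm q < 1" "norm w \<le> 1" and \<rho>: "0 \<le> \<rho>" "\<rho> * norm q < 1"
  shows "pell_gf q w holomorphic_on ball 0 \<rho>"
  unfolding pell_gf_def
proof (rule holomorphic_on_suminf_superexponential)
  show "norm (pell_term q w t (Suc j))
           \<le> (1 + \<rho>) * \<rho> / (1 - \<rho> * norm q) * norm q ^ j * norm (pell_term q w t j)"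
    if "t \<in> ball 0 \<rho>" for j t
    by (rule norm_pell_term_Suc) (use that assms in auto)
  have nz: "1 - t * q * q ^ i \<noteq> 0" if "t \<in> ball 0 \<rho>" for t i
  proof -
    have "norm (t * q) \<le> \<rho> * norm q"
      unfolding norm_mult using that by (intro mult_right_mono) auto
    then have "norm (t * q) < 1" using \<rho> by linarith
    from qpoch_nonzero[OF q(1) this, of "Suc i"] show ?thesis by (auto simp: qpoch_Suc)
  qed
  show "(\<lambda>t. pell_term q w t j) holomorphic_on ball 0 \<rho>" for j
    unfolding pell_term_def qpoch_def
    by (intro holomorphic_intros) (use nz in auto)
  show "norm (pell_term q w t 0) \<le> 1" for t by (simp add: pell_term_def)
qed (use assms in auto)

text \<open>The triple series over \<open>n\<close>, \<open>j\<close>, \<open>k\<close> converges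
  absolutely, hence may be summed over \<open>n\<close> first by
  \<open>qbinomial_shifted_sums\<close>, then over \<open>k\<close> by the \<open>q\<close>-binomial
  theorem, which leaves the series over \<open>j\<close>.\<close>

lemma pell_coeff_gf:
  assumes q: "norm q < 1" and w: "norm w \<le> 1" and t: "norm t < 1"
  shows "(\<lambda>n. pell_coeff q w n * t ^ n) sums (pell_gf q w t / (1 - t))"
proof -
  define a where "a = (\<lambda>j k. qbinomial q j k * q ^ (j * (j + 1) div 2) * q ^ (k * (k - 1) div 2) * w ^ k)"
  \<comment> \<open>Defined on all triples: the default value 0 of \<open>qbinomial\<close> cuts the
    ranges down to \<open>k \<le> j \<le> n\<close>.\<close>
  define h where "h = (\<lambda>(n, (j, k)). a j k * (qbinomial q (n - k) j * t ^ n))"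
  define r where "r = norm q"
  have r: "0 \<le> r" "r < 1" using q by (auto simp: r_def)
  obtain K where K: "K > 0" "\<And>n k. norm (qbinomial q n k) \<le> K"
    using qbinomial_bounded[OF q] by metis
  have abs: "(\<lambda>x. norm (h x)) summable_on UNIV"
  proof (rule Infinite_Sum.abs_summable_on_comparison_test')
    have 1: "(\<lambda>n. norm t ^ n) summable_on UNIV"
      using t by (intro norm_summable_imp_summable_on) (auto intro!: summable_geometric)
    have 2: "(\<lambda>j. r ^ (j * (j + 1) div 2)) summable_on UNIV"
    proof (intro norm_summable_imp_summable_on summable_norm_superexponential[of _ 1 r])
      show "norm (r ^ (Suc n * (Suc n + 1) div 2)) \<le> 1 * r ^ n * norm (r ^ (n * (n + 1) div 2))" for n
        unfolding triangular_Suc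
        using r mult_right_mono[OF power_decreasing[of n "Suc n" r], of "r ^ (n * (n + 1) div 2)"]
        by (simp add: power_add mult_ac)
    qed (use r in auto)
    have 3: "(\<lambda>k. r ^ (k * (k - 1) div 2)) summable_on UNIV"
    proof (intro norm_summable_imp_summable_on summable_norm_superexponential[of _ 1 r])
      show "norm (r ^ (Suc n * (Suc n - 1) div 2)) \<le> 1 * r ^ n * norm (r ^ (n * (n - 1) div 2))" for n
        unfolding choose_two_Suc using r by (simp add: power_add mult_ac)
    qed (use r in auto)
    have "(\<lambda>(n, x). norm t ^ n * (case x of (j, k) \<Rightarrow> r ^ (j * (j + 1) div 2) * r ^ (k * (k - 1) div 2)))
        summable_on UNIV \<times> (UNIV \<times> UNIV)"
      by (intro summable_on_Times_mult 1 2 3) (use r in auto)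
    then have "(\<lambda>x. K * K * (case x of (n, x) \<Rightarrow> norm t ^ n *
        (case x of (j, k) \<Rightarrow> r ^ (j * (j + 1) div 2) * r ^ (k * (k - 1) div 2)))) summable_on UNIV"
      by (intro summable_on_cmult_right) simp
    then show "(\<lambda>(n, (j, k)). K * K * (norm t ^ n * (r ^ (j * (j + 1) div 2) * r ^ (k * (k - 1) div 2))))
        summable_on UNIV"
      by (simp add: case_prod_unfold)
    show "norm (h x) \<le> (case x of (n, (j, k)) \<Rightarrow>
        K * K * (norm t ^ n * (r ^ (j * (j + 1) div 2) * r ^ (k * (k - 1) div 2))))" for x
    proof (cases x)
      case (fields n j k)
      have "norm (h x) = norm (qbinomial q j k) * norm (qbinomial q (n - k) j) *
          (norm t ^ n * (r ^ (j * (j + 1) div 2) * r ^ (k * (k - 1) div 2)) * norm w ^ k)"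
        by (simp add: fields h_def a_def norm_mult norm_power r_def mult_ac)
      also have "\<dots> \<le> K * K * (norm t ^ n * (r ^ (j * (j + 1) div 2) * r ^ (k * (k - 1) div 2)) * 1)"
        using K w r by (intro mult_mono power_le_one) auto
      finally show ?thesis by (simp add: fields)
    qed
  qed
  define S where "S = infsum h UNIV"
  have S: "(h has_sum S) (UNIV \<times> UNIV)"
    unfolding S_def using has_sum_infsum[OF abs_summable_summable[OF abs]] by simp
  have "((\<lambda>x. h (n, x)) has_sum (pell_coeff q w n * t ^ n)) UNIV" for n
  proof -
    have "((\<lambda>x. h (n, x)) has_sum (\<Sum>x\<in>(SIGMA j:{0..n}. {0..j}). h (n, x))) (SIGMA j:{0..n}. {0..j})"
      by (intro has_sum_finite) auto
    also have "(\<Sum>x\<in>(SIGMA j:{0..n}. {0..j}). h (n, x)) = (\<Sum>j=0..n. \<Sum>k=0..j. h (n, (j, k)))"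
      by (subst sum.Sigma) auto
    also have "\<dots> = pell_coeff q w n * t ^ n"
      unfolding pell_coeff_def sum_distrib_right h_def a_def by (simp add: mult_ac)
    finally show ?thesis
    proof (rule has_sum_cong_neutral[THEN iffD1, rotated -1])
      show "h (n, x) = 0" if "x \<in> UNIV - (SIGMA j:{0..n}. {0..j})" for x
      proof (cases x)
        case (Pair j k)
        with that consider "j < k" | "n < j" by (auto simp: not_le)
        then show ?thesis by cases (auto simp: h_def a_def Pair)
      qed
    qed auto
  qed
  then have "((\<lambda>n. pell_coeff q w n * t ^ n) has_sum S) UNIV"
    by (intro has_sum_SigmaD[OF S]) auto
  then have sums: "(\<lambda>n. pell_coeff q w n * t ^ n) sums S"
    by (rule has_sum_imp_sums)
  define b where "b = (\<lambda>(j, k). a j k * (t ^ (j + k) / qpoch t q (Suc j)))"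
  have "((\<lambda>(x, n). h (n, x)) has_sum S) (UNIV \<times> UNIV)"
    using S by (subst (asm) has_sum_swap)
  moreover have "((\<lambda>n. h (n, x)) has_sum (b x)) UNIV" for x
  proof (cases x)
    case (Pair j k)
    show ?thesis
    proof (cases "k \<le> j")
      case True
      have "((\<lambda>n. qbinomial q (n - k) j * t ^ n) has_sum (t ^ (j + k) / qpoch t q (Suc j))) UNIV"
        by (intro norm_summable_imp_has_sum summable_qbinomial_geometric qbinomial_shifted_sums q t True)
      from has_sum_cmult_right[OF this, of "a j k"] show ?thesis
        unfolding Pair h_def b_def by simp
    next
      case False
      then have "a j k = 0" by (simp add: a_def)
      then show ?thesis unfolding Pair h_def b_def by simp
    qed
  qed
  ultimately have "(b has_sum S) UNIV"
    by (intro has_sum_SigmaD[where f = "\<lambda>(x, n). h (n, x)" and B = "\<lambda>_. UNIV"]) auto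
  then have bsum: "(b has_sum S) (UNIV \<times> UNIV)" by simp
  have row: "((\<lambda>k. b (j, k)) has_sum (pell_term q w t j * (1 / (1 - t)))) UNIV" for j
  proof -
    have "((\<lambda>k. b (j, k)) has_sum (\<Sum>k\<le>j. b (j, k))) {..j}"
      by (intro has_sum_finite) auto
    also have "(\<Sum>k\<le>j. b (j, k)) = (\<Sum>k\<le>j. qbinomial q j k * q ^ (k * (k - 1) div 2) * (t * w) ^ k) *
        (t ^ j * q ^ (j * (j + 1) div 2) / qpoch t q (Suc j))"
      unfolding sum_distrib_right b_def a_def by (simp add: power_add power_mult_distrib mult_ac)
    also have "\<dots> = pell_term q w t j * (1 / (1 - t))"
      unfolding q_binomial_theorem[OF q] pell_term_def qpoch_Suc_shift by (simp add: mult_ac)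
    finally show ?thesis
      by (rule has_sum_cong_neutral[THEN iffD1, rotated -1]) (auto simp: b_def a_def)
  qed
  have "((\<lambda>j. pell_term q w t j * (1 / (1 - t))) has_sum S) UNIV"
    by (rule has_sum_SigmaD[OF bsum row])
  then have "(\<lambda>j. pell_term q w t j * (1 / (1 - t))) sums S"
    by (rule has_sum_imp_sums)
  moreover have "norm t * norm q < 1"
    using mult_left_mono[of "norm q" 1 "norm t"] q t by simp
  then have "(\<lambda>j. pell_term q w t j * (1 / (1 - t))) sums (pell_gf q w t * (1 / (1 - t)))"
    by (intro sums_mult2 pell_gf_sums q w)
  ultimately have "S = pell_gf q w t * (1 / (1 - t))" by (rule sums_unique2)
  with sums show ?thesis by simp
qed

section \<open>The sum of the defects as a derivative\<close>

lemma power_series_coeffs_unique: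
  fixes a b :: "nat \<Rightarrow> complex"
  assumes "0 < r" "\<And>z. norm z < r \<Longrightarrow> (\<lambda>n. a n * z ^ n) sums f z"
    and "\<And>z. norm z < r \<Longrightarrow> (\<lambda>n. b n * z ^ n) sums f z"
  shows "a n = b n"
proof (rule ccontr)
  assume neq: "a n \<noteq> b n"
  have d: "(\<lambda>n. (a n - b n) * (z - 0) ^ n) sums 0" if "norm (z - 0) < r" for z
    using sums_diff[OF assms(2)[of z] assms(3)[of z]] that by (simp add: algebra_simps)
  have "a 0 - b 0 = 0"
    using d[of 0] \<open>0 < r\<close> powser_sums_zero[of "\<lambda>n. a n - b n"] sums_unique2 by fastforce
  with neq have "n > 0" by (cases n) auto
  \<comment> \<open>The difference series represents the zero function, but a nonzero coefficient of
    positive index would make that function nonzero on a punctured disc.\<close>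
  obtain s :: real where "0 < s" "\<And>z :: complex. z \<in> cball 0 s - {0} \<Longrightarrow> (0 :: complex) \<noteq> 0"
    by (rule powser_0_nonzero[OF \<open>0 < r\<close> d refl _ \<open>n > 0\<close>]) (use neq in auto)
  from this(2)[of "of_real s"] this(1) show False by simp
qed

text \<open>The function \<open>(G t - G 1) / (t - 1)\<close> has the defects \<open>G 1 - a n\<close> as Taylor coefficients, and it
  is holomorphic in a disc that contains the point \<open>1\<close>, where its value is \<open>G' 1\<close>.\<close>

lemma sums_defect:
  fixes a :: "nat \<Rightarrow> complex"
  assumes hol: "G holomorphic_on ball 0 \<rho>" and "\<rho> > 1"
    and gf: "\<And>t. norm t < 1 \<Longrightarrow> (\<lambda>n. a n * t ^ n) sums (G t / (1 - t))"
  shows "(\<lambda>n. G 1 - a n) sums deriv G 1"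
proof -
  define K where "K = (\<lambda>z. if z = 1 then deriv G 1 else (G z - G 1) / (z - 1))"
  have K: "K holomorphic_on ball 0 \<rho>"
    unfolding K_def by (rule pole_lemma_open[OF hol]) auto
  have ps: "(\<lambda>n. (deriv ^^ n) K 0 / fact n * z ^ n) sums K z" if "norm z < \<rho>" for z
    using holomorphic_power_series[OF K, of z] that by simp
  have "(\<lambda>n. (G 1 - a n) * z ^ n) sums K z" if "norm z < 1" for z
  proof -
    have "(\<lambda>n. G 1 * z ^ n - a n * z ^ n) sums (G 1 * (1 / (1 - z)) - G z / (1 - z))"
      by (intro sums_diff sums_mult geometric_sums gf that)
    moreover have "z \<noteq> 1" using that by auto
    then have "G 1 * (1 / (1 - z)) - G z / (1 - z) = K z"
      by (simp add: K_def divide_simps) (simp add: algebra_simps)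
    ultimately show ?thesis by (simp add: algebra_simps)
  qed
  then have "G 1 - a n = (deriv ^^ n) K 0 / fact n" for n
    using ps \<open>\<rho> > 1\<close> by (intro power_series_coeffs_unique[of 1 _ K]) auto
  then show ?thesis
    using ps[of 1] \<open>\<rho> > 1\<close> by (simp add: K_def)
qed

section \<open>The bilateral series and its two halves\<close>

text \<open>The \<open>n\<close>-th term of \<open>pell_gf\<close>, with
  \<open>w = q powi (1 - e)\<close>, multiplied by
  \<open>qpoch_inf (t * q) q * qpoch_inf (- (q powi e / t)) q\<close>. The finite Pochhammer symbols
  are absorbed into the infinite products, so the formula makes sense for every integer
  \<open>n\<close>.\<close>

definition bilateral_term :: "complex \<Rightarrow> int \<Rightarrow> complex \<Rightarrow> int \<Rightarrow> complex" where
  "bilateral_term q e t n = qpoch_inf (t * q powi (n + 1)) q * qpoch_inf (- (q powi (e - n) / t)) q *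
     t powi (2 * n) * q powi (n * (n + 1 - e))"

lemma bilateral_term_0:
  "bilateral_term q e t 0 = qpoch_inf (t * q) q * qpoch_inf (- (q powi e / t)) q"
  by (simp add: bilateral_term_def)

text \<open>From \<open>n\<close> to \<open>n + 1\<close> each infinite product changes by one
  factor. The cross-multiplied form is valid for all integers without any condition on denominators;
  read upwards it gives the Pell terms, read downwards the dual terms.\<close>

lemma bilateral_term_step:
  assumes q: "norm q < 1" "q \<noteq> 0" and t: "t \<noteq> 0"
  shows "bilateral_term q e t (n + 1) * (1 - t * q powi (n + 1))
           = bilateral_term q e t n * ((1 + t * q powi (n + 1 - e)) * t * q powi (n + 1))"
proof -
  define a where "a = q powi (n + 1 - e)"
  define b where "b = q powi (n + 1)"
  have a: "a \<noteq> 0" using q by (simp add: a_def)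
  have 1: "qpoch_inf (t * b) q = (1 - t * b) * qpoch_inf (t * q powi (n + 1 + 1)) q"
    using qpoch_inf_rec[OF q(1), of "t * b"] power_int_add_1[of q "n + 1"] q
    by (simp add: b_def mult.assoc)
  have "q powi (e - (n + 1)) = 1 / a"
    using q power_int_minus[of q "n + 1 - e"] by (simp add: a_def field_simps)
  moreover have "q powi (e - n) = q powi (e - (n + 1)) * q"
    using q power_int_add_1[of q "e - (n + 1)"] by simp
  ultimately have 2: "qpoch_inf (- (q powi (e - (n + 1)) / t)) q
      = (1 + 1 / (a * t)) * qpoch_inf (- (q powi (e - n) / t)) q"
    using q by (subst qpoch_inf_rec) simp_all
  have 3: "t powi (2 * (n + 1)) = t powi (2 * n) * t ^ 2"
    using t by (simp add: power_int_add distrib_left)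
  have "(n + 1) * (n + 1 + 1 - e) = n * (n + 1 - e) + ((n + 1 - e) + (n + 1))"
    by (simp add: algebra_simps)
  then have 4: "q powi ((n + 1) * (n + 1 + 1 - e)) = q powi (n * (n + 1 - e)) * (a * b)"
    by (simp only: a_def b_def power_int_add[OF disjI1[OF q(2)]])
  have 5: "(1 + 1 / (a * t)) * t ^ 2 * (a * b) = (1 + t * a) * t * b"
    using a t by (simp add: field_simps power2_eq_square)
  have "bilateral_term q e t (n + 1) * (1 - t * b)
      = ((1 - t * b) * qpoch_inf (t * q powi (n + 1 + 1)) q) * qpoch_inf (- (q powi (e - n) / t)) q *
        t powi (2 * n) * q powi (n * (n + 1 - e)) * ((1 + 1 / (a * t)) * t ^ 2 * (a * b))"
    unfolding bilateral_term_def 2 3 4 by (simp only: mult_ac)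
  also have "\<dots> = bilateral_term q e t n * ((1 + t * a) * t * b)"
    unfolding 5 1[symmetric] unfolding bilateral_term_def b_def[symmetric] by (simp only: mult_ac)
  finally show ?thesis by (simp add: a_def b_def)
qed

lemma bilateral_term_nonneg:
  assumes q: "norm q < 1" "q \<noteq> 0" and t: "t \<noteq> 0" "norm (t * q) < 1"
  shows "bilateral_term q e t (int j) = pell_term q (q powi (1 - e)) t j * bilateral_term q e t 0"
proof (induction j)
  case 0
  then show ?case by (simp add: pell_term_def)
next
  case (Suc j)
  have nz: "1 - t * q ^ Suc j \<noteq> 0"
    using qpoch_nonzero[OF q(1) t(2), of "Suc j"] by (auto simp: qpoch_Suc mult_ac)
  have "int j + 1 - e = (1 - e) + int j" by simp
  moreover have "q powi ((1 - e) + int j) = q powi (1 - e) * q powi int j"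
    using q by (intro power_int_add) auto
  ultimately have w: "q powi (int j + 1 - e) = q powi (1 - e) * q ^ j"
    by (simp only: power_int_of_nat)
  have S: "q powi (int j + 1) = q ^ Suc j"
    by (metis of_nat_Suc add.commute power_int_of_nat)
  have "bilateral_term q e t (int (Suc j)) * (1 - t * q ^ Suc j)
      = bilateral_term q e t (int j) * ((1 + t * (q powi (1 - e) * q ^ j)) * t * q ^ Suc j)"
    using bilateral_term_step[OF q t(1), of e "int j"] unfolding w S by (simp add: add.commute)
  then have "bilateral_term q e t (int (Suc j))
      = bilateral_term q e t (int j) * ((1 + t * (q powi (1 - e) * q ^ j)) * t * q ^ Suc j) / (1 - t * q ^ Suc j)"
    using nz by (simp add: field_simps)
  then show ?case unfolding Suc pell_term_Suc by (simp add: mult_ac)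
qed

text \<open>Up to the factor \<open>1 - 1 / t\<close>, the terms with negative index \<open>- 1 - m\<close>, where \<open>v = q\<^sup>e\<close>.\<close>

definition dual_term :: "complex \<Rightarrow> complex \<Rightarrow> complex \<Rightarrow> nat \<Rightarrow> complex" where
  "dual_term q v t m = (- 1) ^ Suc m * qpoch (q / t) q m * (1 / t) ^ Suc m * q ^ (m * (m + 1) div 2) *
     v ^ Suc m / qpoch (- (v / t)) q (Suc m)"

definition dual_gf :: "complex \<Rightarrow> complex \<Rightarrow> complex \<Rightarrow> complex" where
  "dual_gf q v t = (\<Sum>m. dual_term q v t m)"

lemma dual_term_Suc:
  "dual_term q v t (Suc m) = dual_term q v t m *
     (- ((1 - q ^ Suc m / t) * (q ^ Suc m * v / t) / (1 + v * q ^ Suc m / t)))"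
  unfolding dual_term_def triangular_Suc qpoch_Suc[of _ _ "Suc m"] qpoch_Suc[of _ _ m]
  by (simp add: power_add mult_ac)

text \<open>The downward step from index 0 to \<open>- 1\<close> contributes the factor
  \<open>1 - 1 / t\<close>, which all later terms inherit. Hence this half vanishes at
  \<open>t = 1\<close>, and only the value of \<open>dual_gf\<close> at 1 enters the derivative
  there.\<close>

lemma bilateral_term_neg:
  assumes q: "norm q < 1" "q \<noteq> 0" and t: "t \<noteq> 0" and v: "v = q powi e"
    and nz: "\<And>m. 1 + v * q ^ m / t \<noteq> 0"
  shows "bilateral_term q e t (- 1 - int m) = (1 - 1 / t) * dual_term q v t m * bilateral_term q e t 0"
proof -
  have v0: "v \<noteq> 0" using q v by simp
  have step: "bilateral_term q e t (- 1 - int m) = bilateral_term q e t (- int m) *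
      (- ((1 - q ^ m / t) * (q ^ m * v / t) / (1 + v * q ^ m / t)))" for m
  proof -
    define c where "c = q ^ m"
    have c: "c \<noteq> 0" using q by (simp add: c_def)
    have 1: "q powi (- int m) = 1 / c"
      by (simp add: c_def power_int_minus field_simps)
    have 2: "q powi (- int m - e) = 1 / (c * v)"
      using q power_int_diff[of q "- int m" e] unfolding 1 by (simp add: v)
    have eq: "bilateral_term q e t (- int m) * (1 - t * (1 / c))
        = bilateral_term q e t (- 1 - int m) * ((1 + t * (1 / (c * v))) * t * (1 / c))"
      using bilateral_term_step[OF q t, of e "- 1 - int m"] by (simp add: 1 2)
    have n: "t + v * c \<noteq> 0" using nz[of m] t by (auto simp: c_def field_simps)
    have l: "1 - t * (1 / c) = - (t / c) * (1 - c / t)"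
      using c t by (simp add: field_simps)
    have r: "(1 + t * (1 / (c * v))) * t * (1 / c) = (t / c) * (t / (c * v)) * (1 + v * c / t)"
      using c t v0 by (simp add: field_simps)
    have "(t / c) * (bilateral_term q e t (- int m) * (- (1 - c / t)))
        = (t / c) * (bilateral_term q e t (- 1 - int m) * ((t / (c * v)) * (1 + v * c / t)))"
      using eq unfolding l r by (simp only: mult_ac minus_mult_left[symmetric] minus_mult_right[symmetric])
    then have "bilateral_term q e t (- int m) * (- (1 - c / t))
        = bilateral_term q e t (- 1 - int m) * ((t / (c * v)) * (1 + v * c / t))"
      using c t by (simp only: mult_cancel_left) auto
    then have "bilateral_term q e t (- 1 - int m)
        = bilateral_term q e t (- int m) * (- (1 - c / t)) / ((t / (c * v)) * (1 + v * c / t))"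
      using c t v0 nz[of m] unfolding c_def[symmetric] by (intro eq_divide_imp) auto
    then show ?thesis unfolding c_def[symmetric] by (simp add: mult_ac del: minus_diff_eq)
  qed
  show ?thesis
  proof (induction m)
    case 0
    show ?case
      using step[of 0] by (simp add: dual_term_def qpoch_Suc mult_ac)
  next
    case (Suc m)
    have "bilateral_term q e t (- 1 - int (Suc m)) = bilateral_term q e t (- 1 - int m) *
      (- ((1 - q ^ Suc m / t) * (q ^ Suc m * v / t) / (1 + v * q ^ Suc m / t)))"
      using step[of "Suc m"] by (simp add: algebra_simps)
    then show ?case unfolding Suc dual_term_Suc by (simp only: mult_ac)
  qed
qed

text \<open>The ratio involves \<open>1 + v * q ^ Suc m / t\<close> only, which
  \<open>norm q < \<sigma>\<close> keeps away from 0. The denominator \<open>1 + v / t\<close>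
  belongs to the initial term and is treated separately.\<close>

lemma norm_dual_term_Suc:
  assumes "norm q < 1" "norm v \<le> 1" "\<sigma> \<le> norm t" "norm q < \<sigma>"
  shows "norm (dual_term q v t (Suc m))
           \<le> (1 + 1 / \<sigma>) * (1 / \<sigma>) / (1 - norm q / \<sigma>) * norm q ^ m * norm (dual_term q v t m)"
proof -
  have \<sigma>: "\<sigma> > 0" using assms(4) norm_ge_zero[of q] by linarith
  have t: "norm t > 0" "1 / norm t \<le> 1 / \<sigma>"
    using \<sigma> assms by (auto intro!: divide_left_mono mult_pos_pos)
  have qm: "norm (q ^ Suc m) \<le> 1"
    unfolding norm_power using assms by (intro power_le_one) auto
  have "norm (q ^ Suc m / t) = norm (q ^ Suc m) * (1 / norm t)" by (simp add: norm_divide)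
  also have "\<dots> \<le> 1 * (1 / \<sigma>)" using t qm by (intro mult_mono) auto
  finally have 1: "norm (1 - q ^ Suc m / t) \<le> 1 + 1 / \<sigma>"
    using norm_triangle_ineq4[of 1 "q ^ Suc m / t"] by simp
  have "norm (q ^ Suc m) \<le> norm q ^ m"
    unfolding norm_power using assms by (intro power_decreasing) auto
  then have "norm (q ^ Suc m) * norm v * (1 / norm t) \<le> norm q ^ m * 1 * (1 / \<sigma>)"
    using t assms by (intro mult_mono) auto
  then have 2: "norm (q ^ Suc m * v / t) \<le> norm q ^ m * (1 / \<sigma>)"
    by (simp add: norm_mult norm_divide)
  have "norm q ^ Suc m \<le> norm q ^ 1"
    using assms by (intro power_decreasing) auto
  then have "norm v * norm (q ^ Suc m) * (1 / norm t) \<le> 1 * norm q * (1 / \<sigma>)"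
    unfolding norm_power using t assms by (intro mult_mono) auto
  then have "norm (v * q ^ Suc m / t) \<le> norm q / \<sigma>"
    by (simp add: norm_mult norm_divide)
  then have "1 - norm q / \<sigma> \<le> norm (1 + v * q ^ Suc m / t)"
    using norm_triangle_ineq2[of 1 "- (v * q ^ Suc m / t)"] by simp
  moreover have "1 - norm q / \<sigma> > 0" using \<sigma> assms by simp
  ultimately have 3: "1 / norm (1 + v * q ^ Suc m / t) \<le> 1 / (1 - norm q / \<sigma>)"
    by (intro divide_left_mono) (auto intro!: mult_pos_pos)
  have "norm (- ((1 - q ^ Suc m / t) * (q ^ Suc m * v / t) / (1 + v * q ^ Suc m / t)))
      = norm (1 - q ^ Suc m / t) * norm (q ^ Suc m * v / t) * (1 / norm (1 + v * q ^ Suc m / t))"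
    by (simp only: norm_minus_cancel norm_mult norm_divide) simp
  also have "\<dots> \<le> (1 + 1 / \<sigma>) * (norm q ^ m * (1 / \<sigma>)) * (1 / (1 - norm q / \<sigma>))"
    using \<sigma> by (intro mult_mono 1 2 3) auto
  finally have "norm (dual_term q v t m) *
      norm (- ((1 - q ^ Suc m / t) * (q ^ Suc m * v / t) / (1 + v * q ^ Suc m / t)))
      \<le> norm (dual_term q v t m) * ((1 + 1 / \<sigma>) * (norm q ^ m * (1 / \<sigma>)) * (1 / (1 - norm q / \<sigma>)))"
    by (intro mult_left_mono) auto
  then show ?thesis
    unfolding dual_term_Suc norm_mult by (simp add: mult_ac)
qed

lemma summable_dual_term:
  assumes "norm q < 1" "norm v \<le> 1" "norm q < norm t"
  shows "summable (\<lambda>m. norm (dual_term q v t m))"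
proof -
  have "norm t > 0" using assms(3) norm_ge_zero[of q] by linarith
  then have "norm q / norm t \<le> 1" using assms(3) by simp
  then show ?thesis
    by (intro summable_norm_superexponential[OF norm_dual_term_Suc[OF assms(1,2) order_refl assms(3)]])
       (use assms in \<open>auto intro!: divide_nonneg_nonneg mult_nonneg_nonneg\<close>)
qed

section \<open>The triple theta series and its inversion symmetry\<close>

text \<open>The summand obtained from \<open>bilateral_term q e t n\<close> when Euler's expansion
  is applied to both infinite products, with indices \<open>a\<close> and \<open>b\<close>.\<close>

definition theta_term :: "complex \<Rightarrow> int \<Rightarrow> complex \<Rightarrow> int \<times> nat \<times> nat \<Rightarrow> complex" where
  "theta_term q e t = (\<lambda>(n, a, b). euler_coeff q a * euler_coeff q b * (- 1) ^ b *
     t powi (2 * n + int a - int b) * q powi (n * (n + 1 - e) + int a * (n + 1) + int b * (e - n)))"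

text \<open>With \<open>u = n + a\<close> and \<open>v = n - b\<close>, twice the exponent of
  \<open>q\<close> is \<open>u * u + v * v + u + v\<close> for \<open>e = 0\<close> and
  \<open>u * u + v * v + u - v\<close> for \<open>e = 1\<close>. It therefore dominates the exponent
  of \<open>t\<close>, whose powers cost at most \<open>\<bar>2 * n + a - b\<bar>\<close> powers of
  \<open>q\<close> in the annulus, and leaves geometric decay in all three indices.\<close>

lemma theta_exponent_ge:
  fixes n e a b A B :: int
  assumes "e = 0 \<or> e = 1" "0 \<le> a" "0 \<le> b" "2 * A = a * (a - 1)" "2 * B = b * (b - 1)"
  shows "A + B + (n * (n + 1 - e) + a * (n + 1) + b * (e - n)) - \<bar>2 * n + a - b\<bar> \<ge> \<bar>n\<bar> + a + b - 12"
proof -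
  \<comment> \<open>Slope 7 is what is needed: the linear terms use up 1, and halving leaves 3,
    namely one each for \<open>\<bar>u + v\<bar>\<close>, \<open>\<bar>n\<bar>\<close> and
    \<open>a + b\<close>.\<close>
  have sq: "x * x \<ge> 7 * \<bar>x\<bar> - 12" for x :: int
  proof -
    have "(\<bar>x\<bar> - 3) * (\<bar>x\<bar> - 4) \<ge> 0"
      by (cases "\<bar>x\<bar> \<le> 3") (auto intro: mult_nonneg_nonneg mult_nonpos_nonpos)
    moreover have "\<bar>x\<bar> * \<bar>x\<bar> = x * x" by simp
    ultimately show ?thesis by (simp add: algebra_simps)
  qed
  define u where "u = n + a"
  define v where "v = n - b"
  define Z where "Z = A + B + (n * (n + 1 - e) + a * (n + 1) + b * (e - n))"
  from assms(1) have "2 * Z = u * u + v * v + u + v \<or> 2 * Z = u * u + v * v + u - v"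
    using assms(4,5) by (auto simp: Z_def u_def v_def algebra_simps)
  with sq[of u] sq[of v] have "2 * Z \<ge> 6 * \<bar>u\<bar> + 6 * \<bar>v\<bar> - 24"
    by linarith
  moreover have uv: "2 * n + a - b = u + v" by (simp add: u_def v_def)
  moreover have "\<bar>n\<bar> \<le> \<bar>u\<bar> + \<bar>v\<bar>" "a + b = u - v"
    using assms(2,3) by (auto simp: u_def v_def)
  ultimately have "Z - \<bar>u + v\<bar> \<ge> \<bar>n\<bar> + a + b - 12" by linarith
  then show ?thesis by (simp only: Z_def uv)
qed

lemma norm_theta_term_le:
  assumes q: "norm q < 1" "q \<noteq> 0" and t: "norm q \<le> norm t" "norm t \<le> 1 / norm q"
    and e: "e = 0 \<or> e = 1" and K: "\<And>n. norm (1 / qpoch q q n) \<le> K"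
  shows "norm (theta_term q e t (n, a, b))
           \<le> K * K / norm q ^ 12 * (norm q ^ nat \<bar>n\<bar> * (norm q ^ a * norm q ^ b))"
proof -
  define r where "r = norm q"
  have r: "0 < r" "r < 1" using q by (auto simp: r_def)
  define A where "A = a * (a - 1) div 2"
  define B where "B = b * (b - 1) div 2"
  define E where "E = n * (n + 1 - e) + int a * (n + 1) + int b * (e - n)"
  define M where "M = 2 * n + int a - int b"
  have two: "2 * int (m * (m - 1) div 2) = int m * (int m - 1)" for m :: nat
  proof -
    have "even (m * (m - 1))" by (cases m) auto
    then have "2 * (m * (m - 1) div 2) = m * (m - 1)" by (rule dvd_mult_div_cancel)
    then have "2 * int (m * (m - 1) div 2) = int (m * (m - 1))" by linarith
    then show ?thesis by (cases m) (auto simp: algebra_simps)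
  qed
  have X: "\<bar>n\<bar> + int a + int b - 12 \<le> int A + int B + E - \<bar>M\<bar>"
    unfolding E_def M_def A_def B_def by (rule theta_exponent_ge) (use e two in auto)
  have K0: "K \<ge> 0" using order_trans[OF norm_ge_zero K[of 0]] .
  have tM: "norm (t powi M) \<le> r powi (- \<bar>M\<bar>)"
  proof (cases "M \<ge> 0")
    case True
    have "norm t ^ nat M \<le> (1 / r) ^ nat M" using t by (intro power_mono) (auto simp: r_def)
    then show ?thesis
      using True by (simp add: norm_power power_int_def power_one_over inverse_eq_divide)
  next
    case False
    have "norm (1 / t) \<le> 1 / r"
      using t r by (simp add: norm_divide r_def divide_left_mono frac_le)
    then have "norm (1 / t) ^ nat (- M) \<le> (1 / r) ^ nat (- M)" by (intro power_mono) auto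
    then show ?thesis
      using False by (simp add: norm_power power_int_def inverse_eq_divide norm_divide)
  qed
  have "norm (theta_term q e t (n, a, b)) = norm (1 / qpoch q q a) * norm (1 / qpoch q q b) *
      (r powi int A * r powi int B * r powi E * norm (t powi M))"
    by (simp add: theta_term_def euler_coeff_def norm_mult norm_divide norm_power norm_power_int
        A_def B_def E_def M_def r_def mult_ac)
  also have "\<dots> \<le> K * K * (r powi int A * r powi int B * r powi E * r powi (- \<bar>M\<bar>))"
    using r K0 by (intro mult_mono K tM mult_left_mono) auto
  also have "r powi int A * r powi int B * r powi E * r powi (- \<bar>M\<bar>) = r powi (int A + int B + E - \<bar>M\<bar>)"
    using r by (simp add: power_int_add power_int_diff power_int_minus field_simps)
  also have "K * K * \<dots> \<le> K * K * r powi (\<bar>n\<bar> + int a + int b - 12)"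
    using r K0 X by (intro mult_left_mono power_int_decreasing) auto
  also have "r powi (\<bar>n\<bar> + int a + int b - 12) = r ^ nat \<bar>n\<bar> * (r ^ a * r ^ b) / r ^ 12"
  proof -
    have r0: "r \<noteq> 0" using r by simp
    have "r powi (\<bar>n\<bar> + int a + int b - 12) = r powi \<bar>n\<bar> * r powi int a * r powi int b / r powi 12"
      by (simp only: power_int_add[OF disjI1[OF r0]] power_int_diff[OF disjI1[OF r0]])
    moreover have "r powi \<bar>n\<bar> = r ^ nat \<bar>n\<bar>" by (simp add: power_int_def)
    ultimately show ?thesis by (simp add: mult_ac)
  qed
  finally show ?thesis by (simp add: r_def)
qed

lemma has_sum_int_split:
  fixes f :: "int \<Rightarrow> complex"
  assumes "((\<lambda>j. f (int j)) has_sum x) UNIV" "((\<lambda>m. f (- 1 - int m)) has_sum y) UNIV"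
  shows "(f has_sum (x + y)) UNIV"
proof -
  have 1: "(f has_sum x) (range int)"
    using assms(1) by (subst has_sum_reindex) (auto simp: o_def)
  have 2: "(f has_sum y) (range (\<lambda>m. - 1 - int m))"
    using assms(2) by (subst has_sum_reindex) (auto simp: o_def inj_def)
  have "(f has_sum (x + y)) (range int \<union> range (\<lambda>m. - 1 - int m))"
    by (rule has_sum_Un_disjoint[OF 1 2]) auto
  moreover have "range int \<union> range (\<lambda>m. - 1 - int m) = UNIV"
  proof -
    have "n \<in> range int \<union> range (\<lambda>m. - 1 - int m)" for n
    proof (cases "n \<ge> 0")
      case True
      then show ?thesis by (metis UnI1 nonneg_int_cases rangeI)
    next
      case False
      then have "n = - 1 - int (nat (- 1 - n))" by simp
      then show ?thesis by blast
    qed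
    then show ?thesis by blast
  qed
  ultimately show ?thesis by simp
qed

lemma summable_theta_term:
  assumes q: "norm q < 1" "q \<noteq> 0" and t: "norm q \<le> norm t" "norm t \<le> 1 / norm q"
    and e: "e = 0 \<or> e = 1"
  shows "(\<lambda>x. norm (theta_term q e t x)) summable_on UNIV"
proof -
  obtain K where K: "\<And>n. norm (1 / qpoch q q n) \<le> K"
    using qpoch_inverse_bounded[OF q(1) q(1)] by metis
  show ?thesis
  proof (rule Infinite_Sum.abs_summable_on_comparison_test')
    have geo: "(\<lambda>i. norm q ^ i) summable_on UNIV"
      using q by (intro norm_summable_imp_summable_on) (auto simp: norm_power intro!: summable_geometric)
    have geo': "(\<lambda>n. norm q ^ nat \<bar>n\<bar>) summable_on UNIV"
    proof -
      \<comment> \<open>The real series is embedded into the complex numbers so that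
        \<open>has_sum_int_split\<close> applies; real parts recover it.\<close>
      have 1: "((\<lambda>j. complex_of_real (norm q ^ nat \<bar>int j\<bar>)) has_sum
              (\<Sum>\<^sub>\<infinity>j. complex_of_real (norm q ^ j))) UNIV"
        using summable_on_of_real[OF geo, where ?'a = complex] by (simp add: has_sum_infsum)
      have eq: "nat \<bar>- 1 - int j\<bar> = Suc j" for j by simp
      have 2: "((\<lambda>j. complex_of_real (norm q ^ nat \<bar>- 1 - int j\<bar>)) has_sum
              (complex_of_real (norm q) * (\<Sum>\<^sub>\<infinity>j. complex_of_real (norm q ^ j)))) UNIV"
        unfolding eq using has_sum_cmult_right[OF has_sum_infsum[OF summable_on_of_real[OF geo, where ?'a = complex]],
            of "complex_of_real (norm q)"] by simp
      have "(\<lambda>n. complex_of_real (norm q ^ nat \<bar>n\<bar>)) summable_on UNIV"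
        using has_sum_int_split[OF 1 2] summable_on_def by blast
      then have "(\<lambda>n. Re (complex_of_real (norm q ^ nat \<bar>n\<bar>))) summable_on UNIV"
        by (rule summable_on_Re)
      then show ?thesis by simp
    qed
    have "(\<lambda>(n, x). norm q ^ nat \<bar>n\<bar> * (case x of (a, b) \<Rightarrow> norm q ^ a * norm q ^ b))
        summable_on UNIV \<times> (UNIV \<times> UNIV)"
      by (intro summable_on_Times_mult geo geo') auto
    then have "(\<lambda>y. K * K / norm q ^ 12 * (case y of (n, x) \<Rightarrow>
        norm q ^ nat \<bar>n\<bar> * (case x of (a, b) \<Rightarrow> norm q ^ a * norm q ^ b))) summable_on UNIV"
      by (intro summable_on_cmult_right) simp
    then show "(\<lambda>(n, a, b). K * K / norm q ^ 12 * (norm q ^ nat \<bar>n\<bar> * (norm q ^ a * norm q ^ b)))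
        summable_on UNIV"
      by (simp add: case_prod_unfold)
    show "norm (theta_term q e t x) \<le> (case x of (n, a, b) \<Rightarrow>
        K * K / norm q ^ 12 * (norm q ^ nat \<bar>n\<bar> * (norm q ^ a * norm q ^ b)))" for x
      using norm_theta_term_le[OF q t e K] by (cases x) auto
  qed
qed

text \<open>For fixed \<open>n\<close> the summand factors into two Euler series. Absolute
  summability supplies some sum \<open>s\<close> over the pairs, which iterated summation then
  evaluates.\<close>

lemma theta_row_has_sum:
  assumes q: "norm q < 1" "q \<noteq> 0" and t: "norm q \<le> norm t" "norm t \<le> 1 / norm q"
    and e: "e = 0 \<or> e = 1"
  shows "((\<lambda>x. theta_term q e t (n, x)) has_sum bilateral_term q e t n) UNIV"
proof -
  define x where "x = t * q powi (n + 1)"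
  define y where "y = - (q powi (e - n) / t)"
  define c where "c = t powi (2 * n) * q powi (n * (n + 1 - e))"
  have t0: "t \<noteq> 0" using t(1) q by auto
  have term_eq: "theta_term q e t (n, a, b) = c * (euler_coeff q a * x ^ a) * (euler_coeff q b * y ^ b)" for a b
  proof -
    have "t powi (2 * n + int a - int b) = t powi (2 * n) * t ^ a / t ^ b"
      using t0 by (simp add: power_int_diff power_int_add)
    moreover have "q powi (n * (n + 1 - e) + int a * (n + 1) + int b * (e - n))
        = q powi (n * (n + 1 - e)) * (q powi (n + 1)) ^ a * (q powi (e - n)) ^ b"
      using q by (simp add: power_int_add power_int_mult mult.commute[of "int _"])
    moreover have "y ^ b = (- 1) ^ b * (q powi (e - n)) ^ b / t ^ b"
      unfolding y_def by (subst power_minus) (simp add: power_divide)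
    ultimately show ?thesis
      by (simp add: theta_term_def c_def x_def power_mult_distrib mult_ac)
  qed
  have euler: "((\<lambda>a. euler_coeff q a * z ^ a) has_sum qpoch_inf z q) UNIV" for z
    by (intro norm_summable_imp_has_sum summable_euler euler_qpoch_inf q)
  have "theta_term q e t summable_on UNIV \<times> UNIV"
    using abs_summable_summable[OF summable_theta_term[OF assms]] by simp
  then have "(\<lambda>(n, x). theta_term q e t (n, x)) summable_on Sigma UNIV (\<lambda>_. UNIV)"
    by simp
  then have "(\<lambda>x. theta_term q e t (n, x)) summable_on UNIV"
    by (rule summable_on_SigmaD1) auto
  then obtain s where s: "((\<lambda>x. theta_term q e t (n, x)) has_sum s) (UNIV \<times> UNIV)"
    using has_sum_infsum by fastforce
  have "((\<lambda>a. c * (euler_coeff q a * x ^ a) * qpoch_inf y q) has_sum s) UNIV"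
  proof (rule has_sum_SigmaD[OF s])
    show "((\<lambda>b. theta_term q e t (n, a, b)) has_sum (c * (euler_coeff q a * x ^ a) * qpoch_inf y q)) UNIV" for a
      unfolding term_eq by (intro has_sum_cmult_right euler)
  qed
  moreover have "((\<lambda>a. c * (euler_coeff q a * x ^ a) * qpoch_inf y q) has_sum (c * qpoch_inf x q * qpoch_inf y q)) UNIV"
    by (intro has_sum_cmult_right has_sum_cmult_left euler)
  ultimately have "s = c * qpoch_inf x q * qpoch_inf y q"
    by (rule has_sum_unique)
  then have "s = bilateral_term q e t n"
    by (simp add: bilateral_term_def c_def x_def y_def mult_ac)
  then show ?thesis using s by simp
qed

text \<open>With \<open>c\<close> as in the proof, the exponent of \<open>q\<close> is
  \<open>n * (n + c) + a + b * e\<close>, which is unchanged by the substitution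
  \<open>- n - c\<close> for \<open>n\<close>. The prefactor makes the exponent of \<open>t\<close>
  equal to \<open>2 * n + c\<close>, which changes sign.\<close>

lemma theta_term_reflect:
  assumes "q \<noteq> 0" "t \<noteq> 0"
  shows "(1 / t) powi (1 - e) * theta_term q e (1 / t) (n, a, b)
           = t powi (1 - e) * theta_term q e t (- n - (int a - int b + 1 - e), a, b)"
proof -
  define c where "c = int a - int b + 1 - e"
  have l: "(1 / t) powi (1 - e) * (1 / t) powi (2 * n + int a - int b) = t powi (- (2 * n + c))"
    using assms by (simp add: c_def power_int_minus power_int_add[symmetric] power_int_one_over
        power_int_diff power_int_add field_simps)
  have r: "t powi (1 - e) * t powi (2 * (- n - c) + int a - int b) = t powi (- (2 * n + c))"
    using assms by (simp add: c_def power_int_add[symmetric] algebra_simps)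
  have "n * (n + 1 - e) + int a * (n + 1) + int b * (e - n)
      = (- n - c) * ((- n - c) + 1 - e) + int a * ((- n - c) + 1) + int b * (e - (- n - c))"
    by (simp add: c_def algebra_simps)
  then show ?thesis
    unfolding theta_term_def prod.case c_def[symmetric] using l r by (simp add: mult_ac)
qed

text \<open>The shift in the reflection depends on \<open>a\<close> and \<open>b\<close>, so it
  permutes the terms of the triple series but not those of the bilateral one. Absolute convergence
  lets the triple series be both reindexed and summed by rows.\<close>

lemma bilateral_reflect:
  assumes q: "norm q < 1" "q \<noteq> 0" and t: "norm q \<le> norm t" "norm t \<le> 1 / norm q"
    and e: "e = 0 \<or> e = 1"
    and s: "(bilateral_term q e t has_sum s) UNIV" and s': "(bilateral_term q e (1 / t) has_sum s') UNIV"
  shows "(1 / t) powi (1 - e) * s' = t powi (1 - e) * s"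
proof -
  have t0: "t \<noteq> 0" using t(1) q by auto
  have t': "norm q \<le> norm (1 / t)" "norm (1 / t) \<le> 1 / norm q"
    using t q t0 by (auto simp: norm_divide field_simps)
  have sum: "(theta_term q e u has_sum x) UNIV"
    if u: "norm q \<le> norm u" "norm u \<le> 1 / norm q" "(bilateral_term q e u has_sum x) UNIV" for u x
  proof -
    obtain y where y: "(theta_term q e u has_sum y) (UNIV \<times> UNIV)"
      using abs_summable_summable[OF summable_theta_term[OF q u(1,2) e]] has_sum_infsum by fastforce
    have "(bilateral_term q e u has_sum y) UNIV"
      by (rule has_sum_SigmaD[OF y]) (rule theta_row_has_sum[OF q u(1,2) e])
    then have "y = x" using u(3) by (rule has_sum_unique)
    then show ?thesis using y by simp
  qed
  have 1: "((\<lambda>x. t powi (1 - e) * theta_term q e t x) has_sum (t powi (1 - e) * s)) UNIV"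
    by (intro has_sum_cmult_right sum t s)
  have 2: "((\<lambda>x. (1 / t) powi (1 - e) * theta_term q e (1 / t) x) has_sum ((1 / t) powi (1 - e) * s')) UNIV"
    by (intro has_sum_cmult_right sum t' s')
  define \<phi> where "\<phi> = (\<lambda>(n, a, b). (- n - (int a - int b + 1 - e), a, b) :: int \<times> nat \<times> nat)"
  have "((\<lambda>x. (1 / t) powi (1 - e) * theta_term q e (1 / t) x) has_sum (t powi (1 - e) * s)) UNIV
      \<longleftrightarrow> ((\<lambda>x. t powi (1 - e) * theta_term q e t x) has_sum (t powi (1 - e) * s)) UNIV"
    by (rule has_sum_reindex_bij_witness[of _ \<phi> \<phi>])
       (use theta_term_reflect[OF q(2) t0] in \<open>auto simp: \<phi>_def\<close>)
  with 1 2 show ?thesis using has_sum_unique by blast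
qed

section \<open>Convergence and holomorphy near 1\<close>

text \<open>The zeros are the points \<open>- (q powi e * q ^ m)\<close>. The point
  \<open>- 1\<close>, present for \<open>e = 0\<close>, is excluded by the half-plane; all others
  have modulus at most \<open>norm q\<close>.\<close>

lemma dual_denominator_nonzero:
  assumes q: "norm q < 1" "e = 0 \<or> e = (1 :: int)" and t: "norm q < norm t" "Re t > 0"
  shows "1 + q powi e * q ^ m / t \<noteq> 0"
proof
  assume "1 + q powi e * q ^ m / t = 0"
  moreover have t0: "t \<noteq> 0" using t(2) by auto
  ultimately have eq: "q powi e * q ^ m = - t"
    by (simp add: field_simps add_eq_0_iff)
  show False
  proof (cases "e = 0 \<and> m = 0")
    case True
    then have "- t = 1" using eq by simp
    then have "Re (- t) = Re 1" by simp
    then show False using t(2) by simp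
  next
    case False
    have "\<exists>i. q powi e * q ^ m = q ^ Suc i"
    proof (cases "e = 1")
      case True
      then show ?thesis by (intro exI[of _ m]) simp
    next
      case e: False
      with False q(2) obtain i where "m = Suc i" by (cases m) auto
      with e q(2) show ?thesis by (intro exI[of _ i]) simp
    qed
    then obtain i where "q powi e * q ^ m = q ^ Suc i" by blast
    then have "norm t = norm q ^ Suc i" using eq by (metis norm_minus_cancel norm_power)
    also have "\<dots> \<le> norm q ^ 1" using q by (intro power_decreasing) auto
    finally show False using t by simp
  qed
qed

lemma bilateral_has_sum:
  assumes q: "norm q < 1" "q \<noteq> 0" and e: "e = 0 \<or> e = 1"
    and t: "norm q < norm t" "norm t * norm q < 1" "Re t > 0"
  shows "(bilateral_term q e t has_sum (bilateral_term q e t 0 *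
           (pell_gf q (q powi (1 - e)) t + (1 - 1 / t) * dual_gf q (q powi e) t))) UNIV"
proof -
  define v where "v = q powi e"
  define w where "w = q powi (1 - e)"
  have t0: "t \<noteq> 0" using t(3) by auto
  have vw: "norm v \<le> 1" "norm w \<le> 1" using e q by (auto simp: v_def w_def)
  have nz: "1 + v * q ^ m / t \<noteq> 0" for m
    unfolding v_def by (rule dual_denominator_nonzero[OF q(1) e t(1,3)])
  have "(pell_term q w t has_sum pell_gf q w t) UNIV"
    by (intro norm_summable_imp_has_sum summable_pell_term pell_gf_sums q t vw)
  then have "((\<lambda>j. pell_term q w t j * bilateral_term q e t 0) has_sum (pell_gf q w t * bilateral_term q e t 0)) UNIV"
    by (rule has_sum_cmult_left)
  then have 1: "((\<lambda>j. bilateral_term q e t (int j)) has_sum (pell_gf q w t * bilateral_term q e t 0)) UNIV"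
    using t by (subst bilateral_term_nonneg[OF q t0]) (auto simp: norm_mult w_def)
  have "dual_term q v t sums dual_gf q v t"
    unfolding dual_gf_def by (rule summable_sums[OF summable_norm_cancel[OF summable_dual_term[OF q(1) vw(1) t(1)]]])
  then have "(dual_term q v t has_sum dual_gf q v t) UNIV"
    by (rule norm_summable_imp_has_sum[OF summable_dual_term[OF q(1) vw(1) t(1)]])
  from has_sum_cmult_left[OF has_sum_cmult_right[OF this, of "1 - 1 / t"], of "bilateral_term q e t 0"]
  have 2: "((\<lambda>m. bilateral_term q e t (- 1 - int m)) has_sum ((1 - 1 / t) * dual_gf q v t * bilateral_term q e t 0)) UNIV"
    by (subst bilateral_term_neg[OF q t0 v_def nz])
  from has_sum_int_split[OF 1 2] show ?thesis
    by (simp add: v_def w_def algebra_simps)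
qed

lemma holomorphic_dual_gf:
  assumes q: "norm q < 1" "e = 0 \<or> e = 1" and \<sigma>: "norm q < \<sigma>" "\<sigma> < 1"
  shows "dual_gf q (q powi e) holomorphic_on {t. \<sigma> < norm t \<and> Re t > 0}"
proof -
  define v where "v = q powi e"
  define S where "S = {t :: complex. \<sigma> < norm t \<and> Re t > 0}"
  have v: "norm v \<le> 1" using q by (auto simp: v_def)
  have nz: "1 + v * q ^ m / t \<noteq> 0" if "t \<in> S" for t m
    unfolding v_def by (rule dual_denominator_nonzero[OF q]) (use that \<sigma> in \<open>auto simp: S_def\<close>)
  have t0: "t \<noteq> 0" if "t \<in> S" for t using that by (auto simp: S_def)
  have "(\<lambda>t. \<Sum>m. dual_term q v t m) holomorphic_on S"
  proof (rule holomorphic_on_suminf_superexponential)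
    have "open ({t. \<sigma> < norm t} \<inter> {t. Re t > 0})"
      by (intro open_Int open_Collect_less continuous_intros)
    then show "open S" by (simp add: S_def Collect_conj_eq)
    show "(\<lambda>t. dual_term q v t m) holomorphic_on S" for m
      unfolding dual_term_def qpoch_def
      by (intro holomorphic_intros) (use nz t0 in auto)
    show "norm (dual_term q v t (Suc m))
           \<le> (1 + 1 / \<sigma>) * (1 / \<sigma>) / (1 - norm q / \<sigma>) * norm q ^ m * norm (dual_term q v t m)"
      if "t \<in> S" for t m
      by (rule norm_dual_term_Suc[OF q(1) v]) (use that \<sigma> in \<open>auto simp: S_def\<close>)
    show "norm (dual_term q v t 0) \<le> 1 / (\<sigma> - norm q)" if t: "t \<in> S" for t
    proof -
      \<comment> \<open>The initial term equals \<open>- (v / (t + v))\<close>. For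
        \<open>v = 1\<close> the half-plane bounds the denominator below, for \<open>v = q\<close>
        the modulus of \<open>t\<close> does.\<close>
      have "norm (t + v) \<ge> \<sigma> - norm q"
      proof (cases "e = 0")
        case True
        have "1 \<le> Re (t + v)" using True t by (auto simp: S_def v_def)
        also have "\<dots> \<le> norm (t + v)" by (rule complex_Re_le_cmod)
        finally have "1 \<le> norm (t + v)" .
        then show ?thesis using \<sigma> norm_ge_zero[of q] by linarith
      next
        case False
        then have "v = q" using q by (simp add: v_def)
        then show ?thesis using norm_triangle_ineq2[of t "- q"] t by (simp add: S_def)
      qed
      then have "norm v / norm (t + v) \<le> 1 / (\<sigma> - norm q)"
        using v \<sigma> by (intro frac_le) auto
      moreover have "dual_term q v t 0 = - (v / (t + v))"
        using t0[OF t] nz[OF t, of 0] by (simp add: dual_term_def qpoch_Suc field_simps)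
      ultimately show ?thesis by (simp add: norm_divide)
    qed
    have "0 < \<sigma>" using \<sigma> norm_ge_zero[of q] by linarith
    then show "0 \<le> (1 + 1 / \<sigma>) * (1 / \<sigma>) / (1 - norm q / \<sigma>)"
      using \<sigma> by (intro divide_nonneg_nonneg mult_nonneg_nonneg) auto
  qed (use q in auto)
  then show ?thesis unfolding S_def v_def dual_gf_def .
qed

section \<open>The derivative of the generating function at 1\<close>

text \<open>Inversion fixes 1 and has derivative \<open>- 1\<close> there, so the chain rule gives
  \<open>D = - D\<close>.\<close>

lemma DERIV_zero_of_inversion_symmetric:
  fixes f :: "complex \<Rightarrow> complex"
  assumes D: "(f has_field_derivative D) (at 1)"
    and sym: "\<forall>\<^sub>F t in nhds 1. f (1 / t) = f t"
  shows "D = 0"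
proof -
  have "((\<lambda>t. 1 / t) has_field_derivative - 1) (at (1 :: complex))"
    by (auto intro!: derivative_eq_intros)
  moreover have "(f has_field_derivative D) (at (1 / 1))" using D by simp
  ultimately have "((\<lambda>t. f (1 / t)) has_field_derivative D * - 1) (at 1)"
    by (rule DERIV_chain2[rotated])
  then have "(f has_field_derivative D * - 1) (at 1)"
    using sym by (subst (asm) DERIV_cong_ev[OF refl _ refl]) auto
  from DERIV_unique[OF D this] show "D = 0" by simp
qed

text \<open>This is \<open>F' 1 = 0\<close> divided by the two infinite products:
  \<open>t powi (1 - e)\<close> contributes \<open>1 - e\<close>, the products contribute
  \<open>- \<Lambda>\<close>, and \<open>(1 - 1 / t) * dual_gf q v t\<close> contributes the value
  of \<open>dual_gf\<close>, as \<open>1 - 1 / t\<close> has value 0 and derivative 1 at 1.\<close>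

lemma deriv_pell_gf:
  assumes q: "norm q < 1" "q \<noteq> 0" and e: "e = 0 \<or> e = 1"
    and vw: "v = q powi e" "w = q powi (1 - e)"
    and \<Lambda>: "(\<lambda>i. q ^ Suc i / (1 - q ^ Suc i) + v * q ^ i / (1 + v * q ^ i)) sums \<Lambda>"
  shows "deriv (pell_gf q w) 1 = pell_gf q w 1 * (\<Lambda> - of_int (1 - e)) - dual_gf q v 1"
proof -
  \<comment> \<open>Any number strictly between \<open>norm q\<close> and 1 would do. The region
    \<open>U\<close> is then mapped to itself by inversion and lies where both halves of the
    bilateral series converge.\<close>
  define \<sigma> where "\<sigma> = (1 + norm q) / 2"
  have \<sigma>: "norm q < \<sigma>" "\<sigma> < 1" "0 < \<sigma>" using q by (auto simp: \<sigma>_def intro: add_pos_nonneg)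
  define U where "U = {t. \<sigma> < norm t} \<inter> {t. norm t < 1 / \<sigma>} \<inter> {t. Re t > 0}"
  have U: "open U"
    unfolding U_def by (intro open_Int open_Collect_less continuous_intros)
  have U1: "1 \<in> U" using \<sigma> by (auto simp: U_def)
  define P where "P = (\<lambda>V. qpoch_inf V q)"
  define F where "F = (\<lambda>t. t powi (1 - e) * (P (t * q) * P (- (v / t)) *
      (pell_gf q w t + (1 - 1 / t) * dual_gf q v t)))"
  have sum: "(bilateral_term q e t has_sum (P (t * q) * P (- (v / t)) *
      (pell_gf q w t + (1 - 1 / t) * dual_gf q v t))) UNIV" if "t \<in> U" for t
  proof -
    have "norm t * norm q \<le> 1 / \<sigma> * norm q"
      using that by (intro mult_right_mono) (auto simp: U_def)
    also have "\<dots> < 1" using \<sigma> by (simp add: field_simps)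
    finally have "norm t * norm q < 1" .
    then show ?thesis
      using bilateral_has_sum[OF q e, of t] that \<sigma>
      by (simp add: bilateral_term_0 P_def vw U_def)
  qed
  have sym: "F (1 / t) = F t" if t: "t \<in> U" for t
  proof -
    have t0: "t \<noteq> 0" using t by (auto simp: U_def)
    have "norm (1 / t) = 1 / norm t" by (simp add: norm_divide)
    moreover have "\<sigma> < 1 / norm t" "1 / norm t < 1 / \<sigma>"
      using t t0 \<sigma> by (auto simp: U_def field_simps)
    moreover have "Re (1 / t) > 0"
      using t t0 by (auto simp: U_def Re_divide complex_neq_0 add_pos_pos intro!: divide_pos_pos)
    ultimately have t': "1 / t \<in> U" by (simp add: U_def)
    have "1 / \<sigma> \<le> 1 / norm q" using \<sigma> q by (intro divide_left_mono) auto
    then show ?thesis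
      unfolding F_def using bilateral_reflect[OF q _ _ e sum[OF t] sum[OF t']] t \<sigma> by (simp add: U_def)
  qed
  have holP: "P holomorphic_on UNIV" unfolding P_def by (rule holomorphic_qpoch_inf[OF q(1)])
  have P': "(P has_field_derivative deriv P z) (at z)" for z
    using holomorphic_derivI[OF holP open_UNIV] by simp
  have "pell_gf q w holomorphic_on ball 0 (1 / \<sigma>)"
    by (rule holomorphic_pell_gf[OF q(1)]) (use \<sigma> e vw q in \<open>auto simp: field_simps\<close>)
  then have G': "(pell_gf q w has_field_derivative deriv (pell_gf q w) 1) (at 1)"
    by (rule holomorphic_derivI) (use \<sigma> in auto)
  have "dual_gf q v holomorphic_on {t. \<sigma> < norm t \<and> Re t > 0}"
    unfolding vw by (rule holomorphic_dual_gf[OF q(1) e \<sigma>(1,2)])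
  then have "dual_gf q v holomorphic_on U"
    by (rule holomorphic_on_subset) (auto simp: U_def)
  then have K': "(dual_gf q v has_field_derivative deriv (dual_gf q v) 1) (at 1)"
    by (rule holomorphic_derivI[OF _ U U1])
  have Pq: "((\<lambda>t. P (t * q)) has_field_derivative deriv P q * q) (at 1)"
    by (rule DERIV_chain2[of P "deriv P q"]) (auto intro!: derivative_eq_intros P'[of q, simplified])
  have Pv: "((\<lambda>t. P (- (v / t))) has_field_derivative deriv P (- v) * v) (at 1)"
    by (rule DERIV_chain2[of P "deriv P (- v)"]) (auto intro!: derivative_eq_intros P'[of "- v", simplified])
  have T: "((\<lambda>t. t powi (1 - e)) has_field_derivative of_int (1 - e)) (at 1)"
    using e by (auto intro!: derivative_eq_intros)
  have "((\<lambda>t. (1 - 1 / t) * dual_gf q v t) has_field_derivative dual_gf q v 1) (at 1)"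
    by (auto intro!: derivative_eq_intros K')
  from DERIV_mult[OF T DERIV_mult[OF DERIV_mult[OF Pq Pv] DERIV_add[OF G' this]]]
  have F': "(F has_field_derivative
      of_int (1 - e) * (P q * P (- v) * pell_gf q w 1) +
      (deriv P q * q * P (- v) + deriv P (- v) * v * P q) * pell_gf q w 1 +
      P q * P (- v) * (deriv (pell_gf q w) 1 + dual_gf q v 1)) (at 1)" (is "(F has_field_derivative ?D) _")
    unfolding F_def by (simp add: algebra_simps)
  have "\<forall>\<^sub>F t in nhds 1. F (1 / t) = F t"
    using eventually_nhds_in_open[OF U U1] by (rule eventually_mono) (rule sym)
  with F' have D0: "?D = 0" by (rule DERIV_zero_of_inversion_symmetric)
  have Pqnz: "P q \<noteq> 0" unfolding P_def by (intro qpoch_inf_nonzero q)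
  have Pvnz: "P (- v) \<noteq> 0"
    using e
  proof
    assume "e = 0"
    \<comment> \<open>Here \<open>- v = - 1\<close> is on the unit circle; one factor is split off
      so that \<open>qpoch_inf_nonzero\<close>, which needs the open disc, can be used.\<close>
    then have "P (- v) = 2 * P (- q)"
      using qpoch_inf_rec[OF q(1), of "- 1"] by (simp add: P_def vw)
    then show ?thesis using qpoch_inf_nonzero[OF q(1), of "- q"] q by (simp add: P_def)
  next
    assume "e = 1"
    then show ?thesis using qpoch_inf_nonzero[OF q(1), of "- q"] q by (simp add: P_def vw)
  qed
  \<comment> \<open>\<open>\<Lambda>\<close> is minus the logarithmic derivative in
    \<open>t\<close>, at 1, of \<open>P (t * q) * P (- (v / t))\<close>.\<close>
  have \<Lambda>_eq: "\<Lambda> = - q * (deriv P q / P q) + - v * (deriv P (- v) / P (- v))"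
  proof (rule sums_unique2[OF \<Lambda>])
    have "(\<lambda>i. - q * (- (q ^ i) / (1 - q * q ^ i)) + - v * (- (q ^ i) / (1 - (- v) * q ^ i)))
        sums (- q * (deriv P q / P q) + - v * (deriv P (- v) / P (- v)))"
      unfolding P_def
      by (intro sums_add sums_mult logderiv_qpoch_inf) (use q Pqnz Pvnz in \<open>auto simp: P_def\<close>)
    then show "(\<lambda>i. q ^ Suc i / (1 - q ^ Suc i) + v * q ^ i / (1 + v * q ^ i))
        sums (- q * (deriv P q / P q) + - v * (deriv P (- v) / P (- v)))"
      by simp
  qed
  have "\<Lambda> * (P q * P (- v)) = - (deriv P q * q * P (- v) + deriv P (- v) * v * P q)"
    unfolding \<Lambda>_eq using Pqnz Pvnz by (simp add: field_simps)
  then have D: "deriv P q * q * P (- v) + deriv P (- v) * v * P q = - \<Lambda> * (P q * P (- v))"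
    by simp
  have "P q * P (- v) * (of_int (1 - e) * pell_gf q w 1 - \<Lambda> * pell_gf q w 1 +
      (deriv (pell_gf q w) 1 + dual_gf q v 1)) = 0"
    using D0 unfolding D by (simp add: algebra_simps)
  then have "of_int (1 - e) * pell_gf q w 1 - \<Lambda> * pell_gf q w 1 +
      (deriv (pell_gf q w) 1 + dual_gf q v 1) = 0"
    using Pqnz Pvnz by simp
  then show ?thesis by (simp add: algebra_simps)
qed

section \<open>Evaluation at 1 and the two identities\<close>

text \<open>At \<open>t = 1\<close> the series is the one in Lebesgue's identity, and Euler's
  identity rewrites \<open>qpoch_inf (- q) q\<close>.\<close>

lemma pell_gf_1:
  assumes "norm q < 1" "norm w \<le> 1"
  shows "pell_gf q w 1 = qpoch_inf (- w * q) (q ^ 2) / qpoch_inf q (q ^ 2)"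
proof -
  have "pell_term q w 1 = lebesgue_term q w"
    by (simp add: pell_term_def lebesgue_term_def fun_eq_iff)
  then have "pell_term q w 1 sums (qpoch_inf (- w * q) (q ^ 2) * qpoch_inf (- q) q)"
    using lebesgue_identity[OF assms(1)] by simp
  then show ?thesis
    unfolding pell_gf_def qpoch_inf_minus_q[OF assms(1)] by (simp add: sums_iff)
qed

lemma sums_pell_defect:
  assumes q: "norm q < 1" "q \<noteq> 0" and w: "norm w \<le> 1"
  shows "(\<lambda>n. pell_gf q w 1 - pell_coeff q w n) sums deriv (pell_gf q w) 1"
proof -
  \<comment> \<open>For \<open>0 < norm q < 1\<close> this lies strictly between 1 and
    \<open>1 / norm q\<close>.\<close>
  define \<rho> where "\<rho> = 2 / (1 + norm q)"
  have \<rho>: "1 < \<rho>" "\<rho> * norm q < 1"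
    using q by (auto simp: \<rho>_def field_simps add_pos_nonneg)
  show ?thesis
    by (rule sums_defect[OF holomorphic_pell_gf[OF q(1) w _ \<rho>(2)] \<rho>(1) pell_coeff_gf[OF q(1) w]])
       (use \<rho> in auto)
qed

lemma qpell_omega_defect:
  assumes q: "norm q < 1" "q \<noteq> 0"
  shows "(\<lambda>n. qpoch_inf (- (q ^ 2)) (q ^ 2) / qpoch_inf q (q ^ 2) - qpell_omega n q) sums
           (qpoch_inf (- (q ^ 2)) (q ^ 2) / qpoch_inf q (q ^ 2) *
              (- (1 / 2) + 2 * (\<Sum>n. q ^ (2 * (n + 1) - 1) / (1 - q ^ (2 * (n + 1) - 1)))) +
            1 / 2 * (\<Sum>n. qpoch q q n * (- 1) ^ n * q ^ (n * (n + 1) div 2) / qpoch (- q) q n))"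
proof -
  define L where "L = (\<Sum>n. q ^ (2 * (n + 1) - 1) / (1 - q ^ (2 * (n + 1) - 1)))"
  define h where "h = (\<lambda>n. qpoch q q n * (- 1) ^ n * q ^ (n * (n + 1) div 2) / qpoch (- q) q n)"
  have G1: "pell_gf q q 1 = qpoch_inf (- (q ^ 2)) (q ^ 2) / qpoch_inf q (q ^ 2)"
    using pell_gf_1[OF q(1), of q] q by (simp add: power2_eq_square)
  have "(\<lambda>i. q ^ Suc i / (1 - q ^ Suc i) + 1 * q ^ i / (1 + 1 * q ^ i)) sums (2 * L + 1 / 2)"
  proof -
    have "(\<lambda>i. q ^ Suc i / (1 - q ^ Suc i) + q ^ Suc i / (1 + q ^ Suc i)) sums (2 * L)"
      unfolding L_def by (rule lambert_odd[OF q(1)])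
    \<comment> \<open>For \<open>e = 0\<close> the second Lambert sum starts at \<open>q ^ 0\<close>
      rather than at \<open>q ^ 1\<close>. The telescoping difference is \<open>1 / 2\<close>, which
      together with \<open>- of_int (1 - 0)\<close> gives the constant
      \<open>- (1 / 2)\<close>.\<close>
    moreover have "(\<lambda>i. q ^ i / (1 + q ^ i) - q ^ Suc i / (1 + q ^ Suc i)) sums (q ^ 0 / (1 + q ^ 0) - 0 / (1 + 0))"
      by (intro telescope_sums' tendsto_intros LIMSEQ_power_zero q) auto
    ultimately have "(\<lambda>i. (q ^ Suc i / (1 - q ^ Suc i) + q ^ Suc i / (1 + q ^ Suc i)) +
        (q ^ i / (1 + q ^ i) - q ^ Suc i / (1 + q ^ Suc i))) sums (2 * L + (q ^ 0 / (1 + q ^ 0) - 0 / (1 + 0)))"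
      by (rule sums_add)
    then show ?thesis by simp
  qed
  then have d: "deriv (pell_gf q q) 1 = pell_gf q q 1 * (2 * L + 1 / 2 - of_int (1 - 0)) - dual_gf q 1 1"
    by (intro deriv_pell_gf[OF q]) auto
  have dual: "dual_term q 1 1 m = - (1 / 2) * h m" for m
  proof -
    \<comment> \<open>The factor \<open>1 - (- 1) = 2\<close> at the front is the source of the
      coefficient \<open>1 / 2\<close> of the last sum.\<close>
    have "qpoch (- 1) q (Suc m) = 2 * qpoch (- q) q m"
      by (simp add: qpoch_Suc_shift)
    then show ?thesis by (simp add: dual_term_def h_def)
  qed
  have "summable (dual_term q 1 1)"
    by (rule summable_norm_cancel, rule summable_dual_term) (use q in auto)
  then have "summable h" using summable_cmult_iff[of "- (1 / 2)" h] unfolding dual by simp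
  then have "dual_gf q 1 1 = - (1 / 2) * (\<Sum>n. h n)"
    unfolding dual_gf_def dual by (rule suminf_mult)
  with d have "deriv (pell_gf q q) 1 = pell_gf q q 1 * (- (1 / 2) + 2 * L) + 1 / 2 * (\<Sum>n. h n)"
    by (simp add: algebra_simps)
  then show ?thesis
    using sums_pell_defect[OF q, of q] q unfolding G1 qpell_omega_eq L_def h_def by simp
qed

text \<open>The case \<open>e = 1\<close>, \<open>v = q\<close>, \<open>w = 1\<close>, in which
  \<open>lambert_odd\<close> applies without a shift. The last sum is \<open>dual_gf q q 1\<close>
  and enters with a minus sign, in contrast to the plus sign of the formula displayed at the top.
  The coefficient of \<open>q\<close> confirms the minus: the defects for \<open>n = 0\<close> and
  \<open>n = 1\<close> contribute 2 and 1, later ones nothing, and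
  \<open>3 = 2 - (- 1)\<close>.\<close>

lemma qpell_Theta_defect:
  assumes q: "norm q < 1" "q \<noteq> 0"
  shows "(\<lambda>n. qpoch_inf (- q) (q ^ 2) / qpoch_inf q (q ^ 2) - qpell_Theta n q) sums
           (2 * (qpoch_inf (- q) (q ^ 2) / qpoch_inf q (q ^ 2)) *
              (\<Sum>n. q ^ (2 * (n + 1) - 1) / (1 - q ^ (2 * (n + 1) - 1))) -
            (\<Sum>n. qpoch q q n * (- 1) ^ (n + 1) * q ^ ((n + 1) * (n + 2) div 2) / qpoch (- q) q (n + 1)))"
proof -
  define L where "L = (\<Sum>n. q ^ (2 * (n + 1) - 1) / (1 - q ^ (2 * (n + 1) - 1)))"
  have G1: "pell_gf q 1 1 = qpoch_inf (- q) (q ^ 2) / qpoch_inf q (q ^ 2)"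
    using pell_gf_1[OF q(1), of 1] by simp
  have "(\<lambda>i. q ^ Suc i / (1 - q ^ Suc i) + q * q ^ i / (1 + q * q ^ i)) sums (2 * L)"
    using lambert_odd[OF q(1)] unfolding L_def by simp
  then have d: "deriv (pell_gf q 1) 1 = pell_gf q 1 1 * (2 * L - of_int (1 - 1)) - dual_gf q q 1"
    by (intro deriv_pell_gf[OF q]) auto
  have "dual_term q q 1 n
      = qpoch q q n * (- 1) ^ (n + 1) * q ^ ((n + 1) * (n + 2) div 2) / qpoch (- q) q (n + 1)" for n
  proof -
    have "(n + 1) * (n + 2) div 2 = n * (n + 1) div 2 + Suc n"
      using triangular_Suc[of n] by simp
    then show ?thesis by (simp add: dual_term_def power_add mult_ac)
  qed
  then have "dual_gf q q 1 = (\<Sum>n. qpoch q q n * (- 1) ^ (n + 1) * q ^ ((n + 1) * (n + 2) div 2) /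
      qpoch (- q) q (n + 1))"
    unfolding dual_gf_def by presburger
  with d show ?thesis
    using sums_pell_defect[OF q, of 1] unfolding G1 qpell_Theta_eq L_def by (simp add: mult_ac)
qed

lemma qpoch_inf_0 [simp]: "qpoch_inf 0 q = 1"
  by (simp add: qpoch_inf_def)

text \<open>Serves the case \<open>q = 0\<close>, which is excluded above because the bilateral
  terms contain negative powers of \<open>q\<close>. Only \<open>j = k = 0\<close> survives, by the
  convention \<open>0 ^ 0 = 1\<close>.\<close>

lemma pell_coeff_0: "pell_coeff 0 w n = 1"
proof -
  have "pell_coeff 0 w n = (\<Sum>j=0..n. if j = 0 then 1 else 0)"
    unfolding pell_coeff_def
  proof (intro sum.cong refl)
    fix j :: nat
    have "j * (j + 1) div 2 \<noteq> 0" if "j \<noteq> 0"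
      using that triangular_Suc[of "j - 1"] by simp
    then show "(\<Sum>k=0..j. qbinomial 0 j k * qbinomial 0 (n - k) j * 0 ^ (j * (j + 1) div 2) *
        0 ^ (k * (k - 1) div 2) * w ^ k) = (if j = 0 then 1 else (0 :: complex))"
      by (auto simp: power_0_left)
  qed
  then show ?thesis by simp
qed

theorem theorem1:
  fixes q :: complex
  assumes "norm q < 1"
  shows "((\<lambda>n. qpoch_inf (- (q ^ 2)) (q ^ 2) / qpoch_inf q (q ^ 2) - qpell_omega n q) sums
           (qpoch_inf (- (q ^ 2)) (q ^ 2) / qpoch_inf q (q ^ 2) *
              (- (1 / 2) + 2 * (\<Sum>n. q ^ (2 * (n + 1) - 1) / (1 - q ^ (2 * (n + 1) - 1)))) +
            1 / 2 * (\<Sum>n. qpoch q q n * (- 1) ^ n * q ^ (n * (n + 1) div 2) / qpoch (- q) q n))) \<and>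
         ((\<lambda>n. qpoch_inf (- q) (q ^ 2) / qpoch_inf q (q ^ 2) - qpell_Theta n q) sums
           (2 * (qpoch_inf (- q) (q ^ 2) / qpoch_inf q (q ^ 2)) *
              (\<Sum>n. q ^ (2 * (n + 1) - 1) / (1 - q ^ (2 * (n + 1) - 1))) -
            (\<Sum>n. qpoch q q n * (- 1) ^ (n + 1) * q ^ ((n + 1) * (n + 2) div 2) /
                  qpoch (- q) q (n + 1))))"
proof (cases "q = 0")
  case True
  have tri: "n * (n + 1) div 2 \<noteq> 0" if "n \<noteq> 0" for n :: nat
    using that triangular_Suc[of "n - 1"] by simp
  have "(0 :: complex) ^ (n * (n + 1) div 2) = 0" if "n \<noteq> 0" for n
    using tri[OF that] by (simp only: power_0_left if_False)
  then have "(\<Sum>n. qpoch 0 0 n * (- 1) ^ n * 0 ^ (n * (n + 1) div 2) / qpoch (- 0) 0 n) = (1 :: complex)"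
    by (subst suminf_finite[of "{0}"]) (simp_all only: singleton_iff, simp_all)
  moreover have "(n + 1) * (n + 2) div 2 \<noteq> 0" for n :: nat
    using tri[of "n + 1"] by simp
  ultimately show ?thesis
    unfolding True qpell_omega_eq qpell_Theta_eq pell_coeff_0 by (simp add: power_0_left)
next
  case False
  with assms show ?thesis using qpell_omega_defect qpell_Theta_defect by blast
qed

end
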